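(* For every $\varepsilon>0$ there is a constant $C_\varepsilon>0$ such that for all sufficiently large even $n\in\mathbb N$ there exists a binary linear code $\mathcal C\le\mathbb F_2^n$ of rate $1/2$ (i.e. $\dim\mathcal C=n/2$) such that: (1) $\delta(\mathcal C)\ge\delta^{(\mathrm{GV})}(1/2)-\varepsilon$ and $\delta(\mathcal C^\perp)\ge\delta^{(\mathrm{GV})}(1/2)-\varepsilon$; (2) both $\mathcal C$ and $\mathcal C^\perp$ are encodable in time $O_\varepsilon(n)$, i.e. each of them has a generator matrix $G\in\mathbb F_2^{n\times n/2}$ such that the map $x\mapsto Gx$ is computed by a Boolean circuit with fan-in 2 gates of size at most $C_\varepsilon n$.
   Context: For a linear code $\mathcal C\le\mathbb F_2^n$, $\delta(\mathcal C)=\min\{\mathrm{wt}(c):c\in\mathcal C\setminus\{0\}\}$ where $\mathrm{wt}(c)=\frac1n|\{i:c_i\ne0\}|$ is the relative Hamming weight. The dual is $\mathcal C^\perp=\{x\in\mathbb F_2^n:\sum_i x_ic_i=0\ \forall c\in\mathcal C\}$. A generator matrix of a code of dimension $k$ is $G\in\mathbb F_2^{n\times k}$ with $\mathcal C=\{Gx:x\in\mathbb F_2^k\}$. Let $h(x)=x\log_2\frac1x+(1-x)\log_2\frac1{1-x}$ be the binary entropy function, $h^{-1}:[0,1]\to[0,1/2]$ the inverse of its restriction to $[0,1/2]$, and $\delta^{(\mathrm{GV})}(R)=h^{-1}(1-R)$. Encoding time is measured by size of Boolean circuits in which all gates of fan-in 2 are available. *)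

theory Defs
  imports
    Complex_Main
    "HOL-Library.Z2"
    "Jordan_Normal_Form.VS_Connect"
begin

section \<open>Binary linear codes\<close>

definition linear_code :: "nat \<Rightarrow> bit vec set \<Rightarrow> bool" where
  "linear_code n C \<longleftrightarrow> VectorSpace.subspace class_ring C (module_vec TYPE(bit) n)"

definition code_dim :: "nat \<Rightarrow> bit vec set \<Rightarrow> nat" where
  "code_dim n C = vectorspace.dim class_ring (module_vec TYPE(bit) n\<lparr>carrier := C\<rparr>)"

abbreviation dual_code :: "nat \<Rightarrow> bit vec set \<Rightarrow> bit vec set" where
  "dual_code n C \<equiv> vec_module.orthogonal_complement n C"

definition rel_weight :: "bit vec \<Rightarrow> real" where
  "rel_weight c = real (card {i. i < dim_vec c \<and> c $ i \<noteq> 0}) / real (dim_vec c)"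

text \<open>Unspecified for the zero code, where the minimum ranges over the empty set.\<close>

definition rel_distance :: "nat \<Rightarrow> bit vec set \<Rightarrow> real" where
  "rel_distance n C = Min (rel_weight ` (C - {0\<^sub>v n}))"

definition generator_matrix :: "nat \<Rightarrow> nat \<Rightarrow> bit vec set \<Rightarrow> bit mat \<Rightarrow> bool" where
  "generator_matrix n k C G \<longleftrightarrow>
     linear_code n C \<and> code_dim n C = k \<and>
     G \<in> carrier_mat n k \<and> C = {G *\<^sub>v x | x. x \<in> carrier_vec k}"

section \<open>The Gilbert--Varshamov distance\<close>

text \<open>At the endpoints \<open>0\<close> and \<open>1\<close> the value is \<open>0\<close>, by the convention \<open>0 * log 2 (1 / 0) = 0\<close>.\<close>

definition binary_entropy :: "real \<Rightarrow> real" where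
  "binary_entropy x = x * log 2 (1 / x) + (1 - x) * log 2 (1 / (1 - x))"

definition inv_binary_entropy :: "real \<Rightarrow> real" where
  "inv_binary_entropy = the_inv_into {0..1/2} binary_entropy"

definition GV_distance :: "real \<Rightarrow> real" where
  "GV_distance R = inv_binary_entropy (1 - R)"

section \<open>Boolean circuits with arbitrary gates of fan-in 2\<close>

text \<open>
  A circuit is given by its gates in topological order. On \<open>k\<close> inputs, wires \<open>0, \<dots>, k - 1\<close> carry
  the inputs and wire \<open>k + j\<close> carries the value of gate number \<open>j\<close>; each gate reads two (possibly
  equal) earlier wires. Fan-out is unrestricted, any wire may serve as an output, and Boolean
  values are the elements of \<^typ>\<open>bit\<close>.
\<close>

datatype gate = Gate (gate_fun: "bit \<Rightarrow> bit \<Rightarrow> bit") (gate_left: nat) (gate_right: nat)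

datatype circuit = Circuit (circuit_gates: "gate list") (circuit_outputs: "nat list")

definition circuit_wf :: "nat \<Rightarrow> circuit \<Rightarrow> bool" where
  "circuit_wf k c \<longleftrightarrow>
     (\<forall>j < length (circuit_gates c).
        gate_left (circuit_gates c ! j) < k + j \<and> gate_right (circuit_gates c ! j) < k + j) \<and>
     (\<forall>w \<in> set (circuit_outputs c). w < k + length (circuit_gates c))"

fun wire_values :: "gate list \<Rightarrow> bit list \<Rightarrow> bit list" where
  "wire_values [] ws = ws"
| "wire_values (Gate f i j # gs) ws = wire_values gs (ws @ [f (ws ! i) (ws ! j)])"

definition circuit_eval :: "circuit \<Rightarrow> bit vec \<Rightarrow> bit vec" where
  "circuit_eval c x =
     vec_of_list (map ((!) (wire_values (circuit_gates c) (list_of_vec x))) (circuit_outputs c))"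

definition circuit_size :: "circuit \<Rightarrow> nat" where
  "circuit_size c = length (circuit_gates c)"

definition circuit_computes :: "nat \<Rightarrow> circuit \<Rightarrow> (bit vec \<Rightarrow> bit vec) \<Rightarrow> bool" where
  "circuit_computes k c f \<longleftrightarrow> circuit_wf k c \<and> (\<forall>x \<in> carrier_vec k. circuit_eval c x = f x)"

definition encodable_in_size :: "nat \<Rightarrow> nat \<Rightarrow> bit vec set \<Rightarrow> real \<Rightarrow> bool" where
  "encodable_in_size n k C s \<longleftrightarrow>
     (\<exists>G c. generator_matrix n k C G \<and> circuit_computes k c ((*\<^sub>v) G) \<and> real (circuit_size c) \<le> s)"

end

theory Submission
  imports Defs
begin

text \<open>
  Take \<open>C = {(x, A x)}\<close> for a square matrix \<open>A\<close>, so that the dual code is \<open>{(A\<^sup>T y, y)}\<close>. By a union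
  bound both codes are near the Gilbert--Varshamov bound for some \<open>A\<close> in a finite family in which
  \<open>A x\<close> and \<open>A\<^sup>T x\<close> are uniformly distributed for every \<open>x \<noteq> 0\<close>. Such a family with linear-size
  circuits is \<open>A = G\<^sup>T M G\<close>: here \<open>G\<close> generates an asymptotically good code of dimension \<open>k\<close> such that
  \<open>G\<close> and \<open>G\<^sup>T\<close> both have circuits of size \<open>O(k)\<close>, and \<open>M\<close> has \<open>O(k)\<close> random entries at fixed positions
  \<open>(p l, q l)\<close> that meet \<open>supp (G y) \<times> supp (G x)\<close> for all nonzero \<open>x\<close>, \<open>y\<close>. Then \<open>y\<^sup>T A x\<close> is a nonzero
  linear form in the entries of \<open>M\<close> whenever \<open>x, y \<noteq> 0\<close>, which is uniformity.

  The matrices \<open>G\<close> are built recursively as \<open>G\<^sub>k x = (x, B G\<^sub>K R x)\<close> with \<open>K \<approx> k/2\<close>. The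
  sparse matrix \<open>R\<close> is the adjacency matrix of a unique-neighbour expander and hence does not vanish on
  vectors of small nonzero weight; the sparse matrix \<open>B\<close> brings the weight of nonzero codewords of \<open>G\<^sub>K\<close>
  back up to a constant fraction that does not deteriorate with the depth of the recursion.
\<close>

section \<open>Linear maps with small circuits\<close>

text \<open>Straight-line programs seen semantically: \<open>W\<close> and \<open>V\<close> hold the
  functions of the global input that the wires carry before and after \<open>s\<close> gates. Wire
  numbers enter only in \<open>gate_steps_imp_gates\<close>.\<close>

inductive gate_steps :: "nat \<Rightarrow> ('a \<Rightarrow> bit) set \<Rightarrow> ('a \<Rightarrow> bit) set \<Rightarrow> bool" where
  gate_steps_0: "gate_steps 0 W W"
| gate_steps_Suc: "gate_steps s W V \<Longrightarrow> a \<in> V \<Longrightarrow> b \<in> V \<Longrightarrow>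
    gate_steps (Suc s) W (insert (\<lambda>x. f (a x) (b x)) V)"

lemma gate_steps_mono: "gate_steps s W V \<Longrightarrow> W \<subseteq> V"
  by (induction rule: gate_steps.induct) auto

lemma gate_steps_trans:
  assumes "gate_steps t V U" "gate_steps s W V"
  shows "gate_steps (s + t) W U"
  using assms by (induction rule: gate_steps.induct) (auto intro: gate_steps_Suc)

lemma gate_steps_one: "a \<in> V \<Longrightarrow> b \<in> V \<Longrightarrow> gate_steps 1 V (insert (\<lambda>x. f (a x) (b x)) V)"
  using gate_steps_Suc[OF gate_steps_0] by simp

definition mat_app :: "nat \<Rightarrow> (nat \<Rightarrow> nat \<Rightarrow> 'b) \<Rightarrow> (nat \<Rightarrow> 'b) \<Rightarrow> nat \<Rightarrow> 'b::comm_semiring_1" where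
  "mat_app k A x j = (\<Sum>i<k. A j i * x i)"

text \<open>
  The inputs \<open>y\<close> are arbitrary wires of a surrounding circuit rather than the circuit inputs, so
  that costs add up under composition.
\<close>

definition lin_cost :: "nat \<Rightarrow> nat \<Rightarrow> (nat \<Rightarrow> nat \<Rightarrow> bit) \<Rightarrow> nat \<Rightarrow> bool" where
  "lin_cost k m A s \<longleftrightarrow> (\<forall>(W :: (bit vec \<Rightarrow> bit) set) y. W \<noteq> {} \<longrightarrow> (\<forall>i<k. y i \<in> W) \<longrightarrow>
     (\<exists>V t. t \<le> s \<and> gate_steps t W V \<and> (\<forall>j<m. (\<lambda>x. mat_app k A (\<lambda>i. y i x) j) \<in> V)))"

lemma lin_costI:
  assumes "\<And>(W :: (bit vec \<Rightarrow> bit) set) y. W \<noteq> {} \<Longrightarrow> \<forall>i<k. y i \<in> W \<Longrightarrow>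
     \<exists>V t. t \<le> s \<and> gate_steps t W V \<and> (\<forall>j<m. (\<lambda>x. mat_app k A (\<lambda>i. y i x) j) \<in> V)"
  shows "lin_cost k m A s"
  unfolding lin_cost_def by (intro allI impI assms) auto

lemma lin_costD:
  fixes W :: "(bit vec \<Rightarrow> bit) set"
  assumes "lin_cost k m A s" "W \<noteq> {}" "\<forall>i<k. y i \<in> W"
  shows "\<exists>V t. t \<le> s \<and> gate_steps t W V \<and> (\<forall>j<m. (\<lambda>x. mat_app k A (\<lambda>i. y i x) j) \<in> V)"
  using assms(1)[unfolded lin_cost_def, rule_format, of W y] assms(2,3) by simp

lemma lin_cost_mono:
  assumes "lin_cost k m A s" "s \<le> t"
  shows "lin_cost k m A t"
proof (rule lin_costI)
  fix W :: "(bit vec \<Rightarrow> bit) set" and y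
  assume W: "W \<noteq> {}" and y: "\<forall>i<k. y i \<in> W"
  obtain V u where "u \<le> s" and V: "gate_steps u W V"
    "\<forall>j<m. (\<lambda>x. mat_app k A (\<lambda>i. y i x) j) \<in> V"
    using lin_costD[OF assms(1) W y] by (elim exE conjE)
  then have "u \<le> t" using assms(2) by simp
  with V show "\<exists>V u. u \<le> t \<and> gate_steps u W V \<and> (\<forall>j<m. (\<lambda>x. mat_app k A (\<lambda>i. y i x) j) \<in> V)"
    by (intro exI conjI)
qed

text \<open>A sparse matrix as a family of entries: entry \<open>l\<close> puts \<open>c l\<close>
  at row \<open>p l\<close> and column \<open>q l\<close>, and coinciding positions add up. The
  number of entries governs the circuit cost.\<close>

definition incidence :: "'i set \<Rightarrow> ('i \<Rightarrow> 'b) \<Rightarrow> ('i \<Rightarrow> nat) \<Rightarrow> ('i \<Rightarrow> nat) \<Rightarrow> nat \<Rightarrow> nat \<Rightarrow> 'b::comm_semiring_1" where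
  "incidence I c p q j i = (\<Sum>l\<in>I. c l * of_bool (p l = j \<and> q l = i))"

lemma mat_app_incidence:
  assumes "\<And>l. l \<in> I \<Longrightarrow> q l < k"
  shows "mat_app k (incidence I c p q) x j = (\<Sum>l\<in>I. c l * of_bool (p l = j) * x (q l))"
proof -
  have "mat_app k (incidence I c p q) x j = (\<Sum>l\<in>I. \<Sum>i<k. c l * of_bool (p l = j \<and> q l = i) * x i)"
    unfolding mat_app_def incidence_def sum_distrib_right by (rule sum.swap)
  also have "\<dots> = (\<Sum>l\<in>I. c l * of_bool (p l = j) * x (q l))"
  proof (rule sum.cong[OF refl])
    fix l assume "l \<in> I"
    have "(\<Sum>i<k. c l * of_bool (p l = j \<and> q l = i) * x i)
        = (\<Sum>i<k. if q l = i then c l * of_bool (p l = j) * x i else 0)"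
      by (intro sum.cong) auto
    also have "\<dots> = c l * of_bool (p l = j) * x (q l)"
      using assms[OF \<open>l \<in> I\<close>] by simp
    finally show "(\<Sum>i<k. c l * of_bool (p l = j \<and> q l = i) * x i)
        = c l * of_bool (p l = j) * x (q l)" .
  qed
  finally show ?thesis .
qed

lemma sum_insert_select:
  fixes c :: "'i \<Rightarrow> 'b::comm_semiring_1"
  assumes "finite J" "a \<notin> J"
  shows "(\<Sum>l\<in>insert a J. c l * of_bool (p l = j) * z (q l)) =
    (if p a = j then c a * z (q a) + (\<Sum>l\<in>J. c l * of_bool (p l = j) * z (q l))
     else (\<Sum>l\<in>J. c l * of_bool (p l = j) * z (q l)))"
  using assms by simp

text \<open>One gate per entry: the gate for \<open>a\<close> adds \<open>c a\<close> times an input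
  to the partial sum of row \<open>p a\<close>, while the partial sums of all other rows stay valid.
  The extra gate produces the zero form from which every row starts.\<close>

lemma lin_cost_incidence:
  assumes "finite I" "\<And>l. l \<in> I \<Longrightarrow> q l < k"
  shows "lin_cost k m (incidence I c p q) (Suc (card I))"
proof (rule lin_costI)
  fix W :: "(bit vec \<Rightarrow> bit) set" and y
  assume W: "W \<noteq> {}" and y: "\<forall>i<k. y i \<in> W"
  have "\<exists>V. gate_steps (Suc (card J)) W V \<and>
      (\<forall>j. (\<lambda>x. \<Sum>l\<in>J. c l * of_bool (p l = j) * y (q l) x) \<in> V)" if "finite J" "J \<subseteq> I" for J
    using that
  proof (induction J rule: finite_induct)
    case empty
    \<comment> \<open>The constant zero comes from a gate that ignores its arguments; nonemptiness
      of \<open>W\<close> provides a wire for it to read.\<close>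
    obtain w where "w \<in> W" using W by blast
    then have "gate_steps 1 W (insert (\<lambda>x. (\<lambda>_ _. 0) (w x) (w x)) W)" by (intro gate_steps_one)
    then show ?case by auto
  next
    case (insert a J)
    define h where "h j = (\<lambda>x. \<Sum>l\<in>J. c l * of_bool (p l = j) * y (q l) x)" for j
    obtain V where V: "gate_steps (Suc (card J)) W V" "\<And>j. h j \<in> V"
      using insert h_def by auto
    have "y (q a) \<in> V"
      using y assms(2)[of a] insert.prems gate_steps_mono[OF V(1)] by auto
    then have *: "gate_steps (Suc (Suc (card J))) W
        (insert (\<lambda>x. (\<lambda>u v. c a * u + v) (y (q a) x) (h (p a) x)) V)"
      using V by (intro gate_steps_Suc)
    have "(\<lambda>x. \<Sum>l\<in>insert a J. c l * of_bool (p l = j) * y (q l) x)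
        \<in> insert (\<lambda>x. c a * y (q a) x + h (p a) x) V" for j
      using V(2)[of j] insert.hyps by (cases "p a = j")
        (simp_all only: sum_insert_select[of J a c p j "\<lambda>r. y r x" q for x] h_def if_True if_False
          insert_iff simp_thms not_False_eq_True)
    then show ?case using * insert.hyps by (intro exI) auto
  qed
  from this[OF assms(1) subset_refl] obtain V where
    "gate_steps (Suc (card I)) W V" "\<And>j. (\<lambda>x. \<Sum>l\<in>I. c l * of_bool (p l = j) * y (q l) x) \<in> V"
    by blast
  then show "\<exists>V t. t \<le> Suc (card I) \<and> gate_steps t W V \<and>
      (\<forall>j<m. (\<lambda>x. mat_app k (incidence I c p q) (\<lambda>i. y i x) j) \<in> V)"
    using assms(2) by (intro exI[of _ V] exI[of _ "Suc (card I)"]) (simp add: mat_app_incidence)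
qed

section \<open>Products, transposes and systematic extensions of matrices\<close>

definition mat_prod :: "nat \<Rightarrow> (nat \<Rightarrow> nat \<Rightarrow> 'b) \<Rightarrow> (nat \<Rightarrow> nat \<Rightarrow> 'b) \<Rightarrow> nat \<Rightarrow> nat \<Rightarrow> 'b::comm_semiring_1" where
  "mat_prod l B A j i = (\<Sum>r<l. B j r * A r i)"

definition mat_transp :: "(nat \<Rightarrow> nat \<Rightarrow> 'b) \<Rightarrow> nat \<Rightarrow> nat \<Rightarrow> 'b" where
  "mat_transp A i j = A j i"

lemma mat_transp_prod: "mat_transp (mat_prod l B A) = mat_prod l (mat_transp A) (mat_transp B)"
  by (simp add: fun_eq_iff mat_transp_def mat_prod_def mult.commute)

lemma mat_transp_incidence: "mat_transp (incidence I c p q) = incidence I c q p"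
  by (simp add: fun_eq_iff mat_transp_def incidence_def conj_commute)

lemma mat_app_prod: "mat_app k (mat_prod l B A) x j = mat_app l B (mat_app k A x) j"
proof -
  have "mat_app k (mat_prod l B A) x j = (\<Sum>i<k. \<Sum>r<l. B j r * A r i * x i)"
    by (simp add: mat_app_def mat_prod_def sum_distrib_right)
  also have "\<dots> = (\<Sum>r<l. \<Sum>i<k. B j r * A r i * x i)" by (rule sum.swap)
  finally show ?thesis by (simp add: mat_app_def sum_distrib_left mult.assoc)
qed

lemma lin_cost_prod:
  assumes "lin_cost k l A s" "lin_cost l m B t"
  shows "lin_cost k m (mat_prod l B A) (s + t)"
proof (rule lin_costI)
  fix W :: "(bit vec \<Rightarrow> bit) set" and y
  assume W: "W \<noteq> {}" and y: "\<forall>i<k. y i \<in> W"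
  obtain V s' where V: "s' \<le> s" "gate_steps s' W V"
    "\<forall>j<l. (\<lambda>x. mat_app k A (\<lambda>i. y i x) j) \<in> V"
    using lin_costD[OF assms(1) W y] by (elim exE conjE)
  have "V \<noteq> {}" using gate_steps_mono[OF V(2)] W by blast
  obtain U t' where U: "t' \<le> t" "gate_steps t' V U"
    "\<forall>j<m. (\<lambda>x. mat_app l B (\<lambda>i. mat_app k A (\<lambda>i. y i x) i) j) \<in> U"
    using lin_costD[OF assms(2) \<open>V \<noteq> {}\<close> V(3)] by (elim exE conjE)
  show "\<exists>V t'. t' \<le> s + t \<and> gate_steps t' W V \<and>
      (\<forall>j<m. (\<lambda>x. mat_app k (mat_prod l B A) (\<lambda>i. y i x) j) \<in> V)"
    using gate_steps_trans[OF U(2) V(2)] U(1,3) V(1)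
    by (intro exI[of _ U] exI[of _ "s' + t'"]) (simp add: mat_app_prod)
qed

text \<open>The block matrix with the identity above \<open>A\<close>, so that codewords have the
  form (x, A x).\<close>

definition systematic :: "nat \<Rightarrow> (nat \<Rightarrow> nat \<Rightarrow> 'b) \<Rightarrow> nat \<Rightarrow> nat \<Rightarrow> 'b::comm_semiring_1" where
  "systematic k A j i = (if j < k then of_bool (i = j) else A (j - k) i)"

lemma mat_app_systematic:
  "mat_app k (systematic k A) x j = (if j < k then x j else mat_app k A x (j - k))"
proof (cases "j < k")
  case True
  have "mat_app k (systematic k A) x j = (\<Sum>i<k. if i = j then x i else 0)"
    using True unfolding mat_app_def systematic_def by (intro sum.cong) auto
  then show ?thesis using True by simp
next
  case False
  then show ?thesis by (simp add: mat_app_def systematic_def)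
qed

lemma lin_cost_systematic:
  assumes "lin_cost k m A s"
  shows "lin_cost k (k + m) (systematic k A) s"
proof (rule lin_costI)
  fix W :: "(bit vec \<Rightarrow> bit) set" and y
  assume W: "W \<noteq> {}" and y: "\<forall>i<k. y i \<in> W"
  obtain V t where V: "t \<le> s" "gate_steps t W V"
    "\<forall>j<m. (\<lambda>x. mat_app k A (\<lambda>i. y i x) j) \<in> V"
    using lin_costD[OF assms W y] by (elim exE conjE)
  have "(\<lambda>x. mat_app k (systematic k A) (\<lambda>i. y i x) j) \<in> V" if "j < k + m" for j
  proof (cases "j < k")
    case True
    then have "y j \<in> V" using y gate_steps_mono[OF V(2)] by blast
    then show ?thesis using True by (simp add: mat_app_systematic)
  next
    case False
    then show ?thesis using V(3)[rule_format, of "j - k"] that by (simp add: mat_app_systematic)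
  qed
  then show "\<exists>V t. t \<le> s \<and> gate_steps t W V \<and>
      (\<forall>j<k + m. (\<lambda>x. mat_app k (systematic k A) (\<lambda>i. y i x) j) \<in> V)"
    using V(1,2) by (intro exI conjI) auto
qed

lemma sum_lessThan_add: "(\<Sum>i<k + m. f i) = (\<Sum>i<k. f i) + (\<Sum>i<m. f (k + i :: nat))"
  for f :: "nat \<Rightarrow> 'b::comm_monoid_add"
  by (induction m) (simp_all add: add.assoc)

lemma mat_app_transp_systematic:
  assumes "j < k"
  shows "mat_app (k + m) (mat_transp (systematic k A)) x j =
    x j + mat_app m (mat_transp A) (\<lambda>i. x (k + i)) j"
proof -
  have "(\<Sum>i<k. mat_transp (systematic k A) j i * x i) = (\<Sum>i<k. if i = j then x i else 0)"
    by (intro sum.cong) (auto simp: mat_transp_def systematic_def)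
  then show ?thesis using assms
    by (simp add: mat_app_def sum_lessThan_add mat_transp_def systematic_def)
qed

text \<open>The transpose maps (u, v) to u + A^T v. Unlike the systematic map, whose first block
  consists of input wires, it takes \<open>k\<close> more gates for the additions. Transposes are
  costed block by block in this way rather than by a general transposition principle.\<close>

lemma lin_cost_transp_systematic:
  assumes "lin_cost m k (mat_transp A) s"
  shows "lin_cost (k + m) k (mat_transp (systematic k A)) (s + k)"
proof (rule lin_costI)
  fix W :: "(bit vec \<Rightarrow> bit) set" and y
  assume W: "W \<noteq> {}" and y: "\<forall>i<k + m. y i \<in> W"
  define h where "h = (\<lambda>j x. mat_app m (mat_transp A) (\<lambda>i. y (k + i) x) j)"
  have "y (k + i) \<in> W" if "i < m" for i using y[rule_format, of "k + i"] that by simp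
  then have "\<forall>i<m. y (k + i) \<in> W" by blast
  then have "\<exists>V t. t \<le> s \<and> gate_steps t W V \<and> (\<forall>j<k. h j \<in> V)"
    unfolding h_def by (rule lin_costD[OF assms W])
  then obtain V t where V: "t \<le> s" "gate_steps t W V" "\<forall>j<k. h j \<in> V"
    by (elim exE conjE)
  have "\<exists>U. gate_steps (t + l) W U \<and> (\<forall>j<l. (\<lambda>x. y j x + h j x) \<in> U) \<and> V \<subseteq> U" if "l \<le> k" for l
    using that
  proof (induction l)
    case 0
    then show ?case using V(2) by auto
  next
    case (Suc l)
    then obtain U where U: "gate_steps (t + l) W U" "\<And>j. j < l \<Longrightarrow> (\<lambda>x. y j x + h j x) \<in> U" "V \<subseteq> U"
      by auto
    have "y l \<in> U" "h l \<in> U"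
      using y[rule_format, of l] gate_steps_mono[OF U(1)] V(3)[rule_format, of l] U(3) Suc.prems by auto
    then have "gate_steps (Suc (t + l)) W (insert (\<lambda>x. y l x + h l x) U)"
      using gate_steps_Suc[OF U(1), of "y l" "h l" "(+)"] by simp
    then show ?case using U(2,3) by (intro exI) (auto simp: less_Suc_eq)
  qed
  from this[OF le_refl] obtain U where U: "gate_steps (t + k) W U"
    "\<And>j. j < k \<Longrightarrow> (\<lambda>x. y j x + h j x) \<in> U" by auto
  then show "\<exists>V t. t \<le> s + k \<and> gate_steps t W V \<and>
      (\<forall>j<k. (\<lambda>x. mat_app (k + m) (mat_transp (systematic k A)) (\<lambda>i. y i x) j) \<in> V)"
    using V(1) by (intro exI[of _ U] exI[of _ "t + k"]) (simp add: mat_app_transp_systematic h_def)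
qed

section \<open>From straight-line programs to Boolean circuits\<close>

lemma wire_values_append:
  "wire_values (gs @ gs') ws = wire_values gs' (wire_values gs ws)"
  by (induction gs ws rule: wire_values.induct) auto

lemma length_wire_values: "length (wire_values gs ws) = length ws + length gs"
  by (induction gs ws rule: wire_values.induct) auto

text \<open>Each function in \<open>V\<close> is located on a wire of an actual gate list. Appending
  a gate leaves the earlier wires unchanged, so locations persist through the induction.\<close>

lemma gate_steps_imp_gates:
  assumes "gate_steps s W V" "W = {\<lambda>x. x $ i |i. i < k}"
  shows "\<exists>gs. length gs = s \<and>
    (\<forall>j<s. gate_left (gs ! j) < k + j \<and> gate_right (gs ! j) < k + j) \<and>
    (\<forall>h\<in>V. \<exists>w<k + s. \<forall>x\<in>carrier_vec k. wire_values gs (list_of_vec x) ! w = h x)"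
  using assms
proof (induction rule: gate_steps.induct)
  case (gate_steps_0 W)
  show ?case by (auto simp: gate_steps_0 list_of_vec_index)
next
  case (gate_steps_Suc s W V a b f)
  obtain gs where gs: "length gs = s"
    "\<forall>j<s. gate_left (gs ! j) < k + j \<and> gate_right (gs ! j) < k + j"
    and V: "\<forall>h\<in>V. \<exists>w<k + s. \<forall>x\<in>carrier_vec k. wire_values gs (list_of_vec x) ! w = h x"
    using gate_steps_Suc.IH[OF gate_steps_Suc.prems] by (elim exE conjE)
  obtain u v where uv: "u < k + s" "v < k + s"
    "\<And>x. x \<in> carrier_vec k \<Longrightarrow> wire_values gs (list_of_vec x) ! u = a x"
    "\<And>x. x \<in> carrier_vec k \<Longrightarrow> wire_values gs (list_of_vec x) ! v = b x"
    using bspec[OF V gate_steps_Suc.hyps(2)] bspec[OF V gate_steps_Suc.hyps(3)] by blast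
  have len: "length (wire_values gs (list_of_vec x)) = k + s" if "x \<in> carrier_vec k" for x
    using that gs(1) by (simp add: length_wire_values)
  have new: "wire_values (gs @ [Gate f u v]) (list_of_vec x) =
      wire_values gs (list_of_vec x) @ [f (a x) (b x)]" if "x \<in> carrier_vec k" for x
    using uv that by (simp add: wire_values_append)
  have "\<exists>w<k + Suc s. \<forall>x\<in>carrier_vec k.
      wire_values (gs @ [Gate f u v]) (list_of_vec x) ! w = h x"
    if "h \<in> insert (\<lambda>x. f (a x) (b x)) V" for h
  proof (cases "h \<in> V")
    case True
    then obtain w where "w < k + s" "\<forall>x\<in>carrier_vec k. wire_values gs (list_of_vec x) ! w = h x"
      using V by blast
    then show ?thesis by (intro exI[of _ w]) (simp add: new nth_append len)
  next
    case False
    then show ?thesis using that by (intro exI[of _ "k + s"]) (auto simp: new nth_append len)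
  qed
  then show ?case using gs uv(1,2)
    by (intro exI[of _ "gs @ [Gate f u v]"]) (auto simp: nth_append less_Suc_eq)
qed

lemma lin_cost_imp_circuit:
  assumes "lin_cost k m A s" "k > 0"
  shows "\<exists>c. circuit_computes k c ((*\<^sub>v) (mat m k (\<lambda>(j, i). A j i))) \<and> circuit_size c \<le> s"
proof -
  define W :: "(bit vec \<Rightarrow> bit) set" where "W = {\<lambda>x. x $ i |i. i < k}"
  \<comment> \<open>Here \<open>k > 0\<close> enters: \<open>lin_cost\<close> speaks only about
    nonempty sets of wires.\<close>
  have "W \<noteq> {}" using assms(2) unfolding W_def by auto
  moreover have "\<forall>i<k. (\<lambda>x. x $ i) \<in> W" by (auto simp: W_def)
  ultimately have "\<exists>V t. t \<le> s \<and> gate_steps t W V \<and> (\<forall>j<m. (\<lambda>x. mat_app k A (\<lambda>i. x $ i) j) \<in> V)"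
    by (rule lin_costD[OF assms(1)])
  then obtain V t where V: "t \<le> s" "gate_steps t W V"
    "\<forall>j<m. (\<lambda>x. mat_app k A (\<lambda>i. x $ i) j) \<in> V"
    by (elim exE conjE)
  obtain gs where gs: "length gs = t"
    "\<forall>j<t. gate_left (gs ! j) < k + j \<and> gate_right (gs ! j) < k + j"
    and h: "\<forall>h\<in>V. \<exists>w<k + t. \<forall>x\<in>carrier_vec k. wire_values gs (list_of_vec x) ! w = h x"
    using gate_steps_imp_gates[OF V(2) W_def] by (elim exE conjE)
  have "\<exists>w. j < m \<longrightarrow> w < k + t \<and> (\<forall>x\<in>carrier_vec k.
      wire_values gs (list_of_vec x) ! w = mat_app k A (\<lambda>i. x $ i) j)" for j
    using bspec[OF h V(3)[rule_format, of j]] by auto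
  then obtain w where w: "\<And>j. j < m \<Longrightarrow> w j < k + t"
    "\<And>j x. j < m \<Longrightarrow> x \<in> carrier_vec k \<Longrightarrow>
      wire_values gs (list_of_vec x) ! w j = mat_app k A (\<lambda>i. x $ i) j"
    by metis
  define c where "c = Circuit gs (map w [0..<m])"
  have "circuit_wf k c" using gs w(1) by (auto simp: circuit_wf_def c_def)
  moreover have "circuit_eval c x = mat m k (\<lambda>(j, i). A j i) *\<^sub>v x" if "x \<in> carrier_vec k" for x
  proof (rule eq_vecI)
    show "dim_vec (circuit_eval c x) = dim_vec (mat m k (\<lambda>(j, i). A j i) *\<^sub>v x)"
      by (simp add: circuit_eval_def c_def)
    fix j assume "j < dim_vec (mat m k (\<lambda>(j, i). A j i) *\<^sub>v x)"
    then have "j < m" by simp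
    then show "circuit_eval c x $ j = (mat m k (\<lambda>(j, i). A j i) *\<^sub>v x) $ j"
      using that w(2)[of j x]
      by (simp add: circuit_eval_def c_def vec_of_list_index scalar_prod_def mat_app_def lessThan_atLeast0)
  qed
  ultimately show ?thesis using gs(1) V(1)
    by (intro exI[of _ c]) (simp add: circuit_computes_def circuit_size_def c_def)
qed

section \<open>Random sparse matrices\<close>

text \<open>The union bound in counting form: the probabilistic arguments below all count in a
  finite sample space.\<close>

lemma exists_avoiding_all:
  assumes "finite \<Omega>" "finite I" "(\<Sum>i\<in>I. real (card {\<omega>\<in>\<Omega>. bad i \<omega>})) < real (card \<Omega>)"
  shows "\<exists>\<omega>\<in>\<Omega>. \<forall>i\<in>I. \<not> bad i \<omega>"
proof (rule ccontr)
  assume "\<not> ?thesis"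
  then have "\<Omega> \<subseteq> (\<Union>i\<in>I. {\<omega>\<in>\<Omega>. bad i \<omega>})" by blast
  then have "card \<Omega> \<le> card (\<Union>i\<in>I. {\<omega>\<in>\<Omega>. bad i \<omega>})"
    using assms(1,2) by (intro card_mono) auto
  also have "\<dots> \<le> (\<Sum>i\<in>I. card {\<omega>\<in>\<Omega>. bad i \<omega>})"
    by (rule card_UN_le[OF assms(2)])
  finally have "real (card \<Omega>) \<le> real (\<Sum>i\<in>I. card {\<omega>\<in>\<Omega>. bad i \<omega>})"
    by (simp only: of_nat_le_iff)
  then show False using assms(3) by simp
qed

section \<open>Random sparse bipartite graphs expand small sets\<close>

lemma power_self_le_fact: "real n ^ n \<le> 3 ^ n * fact n"
proof (induction n)
  case (Suc n)
  show ?case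
  proof (cases "n = 0")
    case False
    \<comment> \<open>The ratio of consecutive values of n^n / n! is (1 + 1/n)^n, which stays below
      e.\<close>
    have "(1 + 1 / real n) ^ n \<le> exp (1 / real n) ^ n"
      by (intro power_mono exp_ge_add_one_self) auto
    also have "\<dots> = exp 1" using False by (simp flip: exp_of_nat_mult)
    also have "\<dots> \<le> 3" by (rule exp_le)
    finally have *: "(1 + 1 / real n) ^ n \<le> 3" .
    have "real (Suc n) ^ Suc n = real (Suc n) * (real n * (1 + 1 / real n)) ^ n"
      using False by (simp add: distrib_left add.commute)
    also have "\<dots> = real (Suc n) * (real n ^ n * (1 + 1 / real n) ^ n)"
      by (simp only: power_mult_distrib)
    also have "\<dots> \<le> real (Suc n) * ((3 ^ n * fact n) * 3)"
      using * Suc.IH by (intro mult_left_mono mult_mono) auto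
    finally show ?thesis by (simp add: algebra_simps)
  qed simp
qed simp

text \<open>The bound (3 n / w)^w on the binomial coefficient, in a form without division.\<close>

lemma binomial_power_self_le: "real (n choose w) * real w ^ w \<le> (3 * real n) ^ w"
proof -
  have "real (n choose w) * real w ^ w \<le> real (n choose w) * (3 ^ w * fact w)"
    by (intro mult_left_mono power_self_le_fact) auto
  also have "\<dots> = 3 ^ w * real ((n choose w) * fact w)" by simp
  also have "\<dots> \<le> 3 ^ w * real (n ^ w)"
    by (intro mult_left_mono of_nat_mono binomial_fact_pow) auto
  finally show ?thesis by (simp add: power_mult_distrib)
qed

text \<open>One weight class in the union bound for expanders: the choices of a set of size
  \<open>w\<close> and of a target of size \<open>2 * w\<close>, times the ways to send all
  \<open>4 * w\<close> edges into that target. Relative to all ways of placing these edges this is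
  at most 4^-w, a summable amount.\<close>

lemma expander_union_term:
  assumes "w > 0" "1728 * w \<le> k" "k \<le> 2 * K"
  shows "real (k choose w) * real (K choose (2 * w)) * real (2 * w) ^ (4 * w) \<le> (1/4) ^ w * real K ^ (4 * w)"
proof -
  have K: "1728 * real w \<le> 2 * real K" using assms by linarith
  have "real (k choose w) * real w ^ w \<le> (3 * real k) ^ w" by (rule binomial_power_self_le)
  also have "\<dots> \<le> (6 * real K) ^ w" using assms(3) by (intro power_mono) auto
  finally have 1: "real (k choose w) * real w ^ w \<le> (6 * real K) ^ w" .
  have 2: "real (K choose (2 * w)) * real (2 * w) ^ (2 * w) \<le> (3 * real K) ^ (2 * w)"
    by (rule binomial_power_self_le)
  have e: "real (2 * w) ^ (4 * w) = real (2 * w) ^ (2 * w) * real (2 * w) ^ (2 * w)"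
    by (subst power_add[symmetric]) (simp del: of_nat_mult)
  \<comment> \<open>The extra factor \<open>w ^ w\<close> is consumed by the first binomial bound;
    it reappears at the end and cancels.\<close>
  have "real (k choose w) * real (K choose (2 * w)) * real (2 * w) ^ (4 * w) * real w ^ w
      = (real (k choose w) * real w ^ w) * (real (K choose (2 * w)) * real (2 * w) ^ (2 * w)) *
        real (2 * w) ^ (2 * w)"
    unfolding e by (simp only: mult_ac)
  also have "\<dots> \<le> (6 * real K) ^ w * (3 * real K) ^ (2 * w) * real (2 * w) ^ (2 * w)"
    by (intro mult_right_mono mult_mono 1 2) auto
  also have "\<dots> = (6 * real K * (3 * real K)^2 * (2 * real w)^2) ^ w"
    by (simp only: power_mult_distrib power_mult of_nat_mult of_nat_numeral)
  also have "6 * real K * (3 * real K)^2 * (2 * real w)^2 = (real K ^ 3 * real w) * (216 * real w)"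
    by (simp add: power2_eq_square power3_eq_cube)
  \<comment> \<open>From 1728 w <= k <= 2 K one gets 216 w <= K / 4; this is the source of the
    threshold 1728 = 8 * 216.\<close>
  also have "\<dots> ^ w \<le> ((real K ^ 3 * real w) * (real K / 4)) ^ w"
    using K by (intro power_mono mult_left_mono) auto
  also have "(real K ^ 3 * real w) * (real K / 4) = (1/4) * real K ^ 4 * real w"
    by (simp add: power3_eq_cube power4_eq_xxxx)
  also have "\<dots> ^ w = ((1/4) ^ w * real K ^ (4 * w)) * real w ^ w"
    by (simp only: power_mult_distrib power_mult)
  finally show ?thesis using assms(1) by (simp add: mult_le_cancel_right)
qed

text \<open>A random \<open>f\<close> is a bipartite multigraph of left degree 4 with edges (i, e).
  If a set S fails, its 4 |S| edges all end in some set of size exactly 2 |S|, and the expected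
  number of such pairs is at most the geometric sum 1/3. Having more neighbours than half the number
  of edges is what later forces a unique neighbour.\<close>

lemma exists_sparse_expander:
  assumes "k \<le> 2 * K" "K > 0"
  shows "\<exists>f. (\<forall>i<k. \<forall>e<4. f (i, e) < K) \<and>
    (\<forall>S\<subseteq>{..<k}. S \<noteq> {} \<longrightarrow> 1728 * card S \<le> k \<longrightarrow> 2 * card S < card (f ` (S \<times> {..<4::nat})))"
proof -
  define D :: "(nat \<times> nat) set" where "D = {..<k} \<times> {..<4}"
  have D: "finite D" "card D = 4 * k" by (auto simp: D_def)
  define \<Omega> where "\<Omega> = PiE D (\<lambda>_. {..<K})"
  have card_\<Omega>: "card \<Omega> = K ^ (4 * k)" and fin_\<Omega>: "finite \<Omega>"
    using D by (auto simp: \<Omega>_def card_PiE intro!: finite_PiE)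
  define Ws where "Ws = {w. 0 < w \<and> 1728 * w \<le> k}"
  have Ws: "finite Ws" "Ws \<subseteq> {1..k}" by (auto simp: Ws_def intro: finite_subset[of _ "{..k}"])
  define P where "P w = {S. S \<subseteq> {..<k} \<and> card S = w} \<times> {T. T \<subseteq> {..<K} \<and> card T = 2 * w}" for w
  have P: "finite (P w)" "card (P w) = (k choose w) * (K choose (2 * w))" for w
    using n_subsets[of "{..<k}" w] n_subsets[of "{..<K}" "2 * w"]
    by (auto simp: P_def card_cartesian_product)
  define bad where "bad = (\<lambda>(w :: nat, S :: nat set, T :: nat set) f. f ` (S \<times> {..<4::nat}) \<subseteq> T)"
  have card_bad: "card {f\<in>\<Omega>. bad (w, S, T) f} = (2 * w) ^ (4 * w) * K ^ (4 * k - 4 * w)"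
    if "w \<in> Ws" "(S, T) \<in> P w" for w S T
  proof -
    have ST: "S \<subseteq> {..<k}" "card S = w" "T \<subseteq> {..<K}" "card T = 2 * w" using that(2) by (auto simp: P_def)
    define E where "E = S \<times> {..<4::nat}"
    have E: "E \<subseteq> D" "card E = 4 * w" "finite E"
      using ST finite_subset[OF ST(1)] by (auto simp: E_def D_def card_cartesian_product)
    have "{f\<in>\<Omega>. bad (w, S, T) f} = PiE D (\<lambda>l. if l \<in> E then T else {..<K})"
    proof (rule Set.set_eqI)
      fix f
      have "bad (w, S, T) f \<longleftrightarrow> (\<forall>l\<in>E. f l \<in> T)" by (simp add: bad_def E_def image_subset_iff)
      moreover have "(\<forall>l\<in>E. f l \<in> T) \<and> (\<forall>l\<in>D. f l \<in> {..<K}) \<longleftrightarrow>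
          (\<forall>l\<in>D. f l \<in> (if l \<in> E then T else {..<K}))"
        using E(1) ST(3) by (auto split: if_splits)
      ultimately show "f \<in> {f\<in>\<Omega>. bad (w, S, T) f} \<longleftrightarrow> f \<in> PiE D (\<lambda>l. if l \<in> E then T else {..<K})"
        unfolding \<Omega>_def PiE_iff by blast
    qed
    then have "card {f\<in>\<Omega>. bad (w, S, T) f} = (\<Prod>l\<in>D. if l \<in> E then 2 * w else K)"
      using D(1) by (simp add: card_PiE if_distrib ST(4) cong: if_cong)
    also have "\<dots> = (2 * w) ^ card (D \<inter> {l. l \<in> E}) * K ^ card (D \<inter> - {l. l \<in> E})"
      using D(1) by (simp add: prod.If_cases)
    also have "D \<inter> {l. l \<in> E} = E" using E(1) by blast
    also have "D \<inter> - {l. l \<in> E} = D - E" by blast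
    finally show ?thesis using E D by (simp add: card_Diff_subset)
  qed
  have "(\<Sum>i\<in>Sigma Ws P. real (card {f\<in>\<Omega>. bad i f}))
      = (\<Sum>w\<in>Ws. \<Sum>(S, T)\<in>P w. real (card {f\<in>\<Omega>. bad (w, S, T) f}))"
    using sum.Sigma[of Ws P "\<lambda>w ST. real (card {f\<in>\<Omega>. bad (w, ST) f})"] Ws(1) P(1)
    by (simp add: case_prod_unfold)
  also have "\<dots> = (\<Sum>w\<in>Ws. \<Sum>(S, T)\<in>P w. real ((2 * w) ^ (4 * w) * K ^ (4 * k - 4 * w)))"
    by (intro sum.cong refl) (auto simp only: card_bad split: prod.split)
  also have "\<dots> = (\<Sum>w\<in>Ws. real (k choose w) * real (K choose (2 * w)) * real (2 * w) ^ (4 * w) *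
      real K ^ (4 * k - 4 * w))"
    by (intro sum.cong) (simp_all add: P(2) case_prod_unfold)
  also have "\<dots> \<le> (\<Sum>w\<in>Ws. (1/4) ^ w * real K ^ (4 * w) * real K ^ (4 * k - 4 * w))"
    by (intro sum_mono mult_right_mono expander_union_term[OF _ _ assms(1)]) (auto simp: Ws_def)
  also have "\<dots> = (\<Sum>w\<in>Ws. (1/4) ^ w * real K ^ (4 * k))"
    using Ws(2) by (intro sum.cong) (auto simp flip: power_add)
  also have "\<dots> = (\<Sum>w\<in>Ws. (1/4) ^ w) * real K ^ (4 * k)" by (simp add: sum_distrib_right)
  also have "\<dots> \<le> (\<Sum>w=1..k. (1/4) ^ w) * real K ^ (4 * k)"
    using Ws by (intro mult_right_mono sum_mono2) auto
  also have "(\<Sum>w=1..k. (1/4::real) ^ w) = (1 - (1/4) ^ k) / 3"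
    by (induction k) (simp_all add: diff_divide_distrib)
  also have "(1 - (1/4) ^ k) / 3 * real K ^ (4 * k) < 1 * real K ^ (4 * k)"
  proof (intro mult_strict_right_mono)
    have "(1 - x) / 3 < 1" if "0 \<le> x" for x :: real using that by simp
    from this[OF zero_le_power[of "1/4" k]] show "(1 - (1/4::real) ^ k) / 3 < 1" by fastforce
  qed (use assms in simp)
  finally obtain f where f: "f \<in> \<Omega>" "\<And>w S T. w \<in> Ws \<Longrightarrow> (S, T) \<in> P w \<Longrightarrow> \<not> bad (w, S, T) f"
    using exists_avoiding_all[OF fin_\<Omega>, of "Sigma Ws P" bad] Ws(1) P(1) card_\<Omega> by auto
  have "2 * card S < card (f ` (S \<times> {..<4}))"
    if S: "S \<subseteq> {..<k}" "S \<noteq> {}" "1728 * card S \<le> k" for S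
  proof (rule ccontr)
    assume *: "\<not> ?thesis"
    have sub: "f ` (S \<times> {..<4}) \<subseteq> {..<K}" using f(1) S(1) by (auto simp: \<Omega>_def D_def PiE_iff)
    have "card S > 0" using S finite_subset[OF S(1)] by (simp add: card_gt_0_iff)
    have "2 * card S \<le> K" using S(3) assms by linarith
    \<comment> \<open>The image is padded to size exactly \<open>2 * card S\<close>, the only size
      that the union bound ranged over.\<close>
    then obtain T where T: "f ` (S \<times> {..<4}) \<subseteq> T" "T \<subseteq> {..<K}" "card T = 2 * card S"
      using exists_subset_between[OF _ _ sub, of "2 * card S"] * by auto
    show False using f(2)[of "card S" S T] S T \<open>card S > 0\<close> by (auto simp: Ws_def P_def bad_def)
  qed
  moreover have "f (i, e) < K" if "i < k" "e < 4" for i e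
    using f(1) that by (auto simp: \<Omega>_def D_def PiE_iff)
  ultimately show ?thesis by blast
qed

section \<open>Weights, characters and random parity checks\<close>

definition hweight :: "nat \<Rightarrow> (nat \<Rightarrow> 'b::zero) \<Rightarrow> nat" where
  "hweight m v = card {i\<in>{..<m}. v i \<noteq> 0}"

lemma prod_hweight:
  "(\<Prod>i<m. if v i = 0 then 1 else a) = (a :: 'a :: comm_semiring_1) ^ hweight m v"
proof -
  have "(\<Prod>i<m. if v i = 0 then 1 else a) = (\<Prod>i\<in>{i\<in>{..<m}. v i \<noteq> 0}. a)"
    by (intro prod.mono_neutral_cong_right) auto
  then show ?thesis by (simp add: hweight_def)
qed

text \<open>The nontrivial additive character of F_2. It turns parities into products, so that sums
  over independent indices factorise.\<close>

definition bit_sign :: "bit \<Rightarrow> real" where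
  "bit_sign b = (if b = 0 then 1 else -1)"

lemma bit_sign_0 [simp]: "bit_sign 0 = 1" and bit_sign_1 [simp]: "bit_sign 1 = -1"
  by (simp_all add: bit_sign_def)

lemma bit_sign_add: "bit_sign (a + b) = bit_sign a * bit_sign b"
  by (cases a; cases b) simp_all

lemma bit_sign_sum: "bit_sign (\<Sum>i\<in>A. g i) = (\<Prod>i\<in>A. bit_sign (g i))"
proof (induction A rule: infinite_finite_induct)
  case (insert a A)
  then show ?case by (simp only: sum.insert prod.insert bit_sign_add simp_thms not_False_eq_True)
qed auto

lemma sum_bit_sign: "(\<Sum>i<m. bit_sign (z i)) = real m - 2 * real (hweight m z)"
proof -
  have "(\<Sum>i<m. bit_sign (z i)) = (\<Sum>i<m. 1 - 2 * of_bool (z i \<noteq> 0))"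
    by (intro sum.cong) (auto simp: bit_sign_def)
  also have "\<dots> = real m - 2 * (\<Sum>i<m. of_bool (z i \<noteq> 0))"
    by (simp add: sum_subtractf sum_distrib_left)
  also have "(\<Sum>i<m. of_bool (z i \<noteq> 0) :: real) = real (hweight m z)"
    by (simp add: hweight_def of_bool_def sum.If_cases Int_def)
  finally show ?thesis .
qed

text \<open>
  Indices \<open>\<ge> m\<close> are dummies that contribute \<open>0\<close>. With indices drawn from \<open>{..<2 * m}\<close> each summand is
  nonzero with probability at most \<open>1/2\<close>; without dummies the parity of \<open>d\<close> samples from
  a vector of full weight would be constant.
\<close>

definition sample :: "nat \<Rightarrow> nat \<Rightarrow> (nat \<Rightarrow> nat) \<Rightarrow> (nat \<Rightarrow> bit) \<Rightarrow> bit" where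
  "sample m d f z = (\<Sum>e<d. of_bool (f e < m) * z (f e))"

text \<open>The character sum splits into \<open>d\<close> equal factors. The dummies raise each
  factor from m - 2 wt to 2 m - 2 wt, which is never negative.\<close>

lemma sum_bit_sign_sample:
  "(\<Sum>f\<in>PiE {..<d} (\<lambda>_. {..<2 * m}). bit_sign (sample m d f z)) =
    (2 * real m - 2 * real (hweight m z)) ^ d"
proof -
  define z' where "z' i = of_bool (i < m) * z i" for i
  have "hweight (2 * m) z' = hweight m z"
    unfolding hweight_def by (intro arg_cong[of _ _ card]) (auto simp: z'_def)
  then have *: "(\<Sum>i<2 * m. bit_sign (z' i)) = 2 * real m - 2 * real (hweight m z)"
    using sum_bit_sign[of z' "2 * m"] by simp
  have "(\<Sum>f\<in>PiE {..<d} (\<lambda>_. {..<2 * m}). bit_sign (sample m d f z)) =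
      (\<Sum>f\<in>PiE {..<d} (\<lambda>_. {..<2 * m}). \<Prod>e<d. bit_sign (z' (f e)))"
    by (simp only: sample_def bit_sign_sum z'_def)
  also have "\<dots> = (\<Prod>e<d. \<Sum>i<2 * m. bit_sign (z' i))"
    by (rule prod_sum_PiE[symmetric]) auto
  finally show ?thesis by (simp add: *)
qed

text \<open>The sign of a sample has mean at most (1 - \<beta>)^d <= 1/2, so the sample vanishes
  with probability at most 3/4, and 3/4 + 1/4 * 1/16 = 49/64. The value 1/16 is the base of the
  exponential moment in \<open>exists_good_samples\<close>.\<close>

lemma sum_sample_le:
  assumes "\<beta> * real m \<le> real (hweight m z)" "(1 - \<beta>) ^ d \<le> 1/2"
  shows "(\<Sum>f\<in>PiE {..<d} (\<lambda>_. {..<2 * m}). if sample m d f z = 0 then 1 else 1/16)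
    \<le> 49/64 * (2 * real m) ^ d"
proof -
  define F where "F = PiE {..<d} (\<lambda>_. {..<2 * m})"
  have "hweight m z \<le> m" using card_mono[of "{..<m}" "{i\<in>{..<m}. z i \<noteq> 0}"] by (auto simp: hweight_def)
  then have "(2 * real m - 2 * real (hweight m z)) ^ d \<le> (2 * real m * (1 - \<beta>)) ^ d"
    using assms(1) by (intro power_mono) (auto simp: algebra_simps)
  also have "\<dots> \<le> (2 * real m) ^ d * (1/2)"
    unfolding power_mult_distrib[of "2 * real m"] using assms(2) by (intro mult_left_mono) auto
  finally have s: "(\<Sum>f\<in>F. bit_sign (sample m d f z)) \<le> (2 * real m) ^ d / 2"
    unfolding F_def sum_bit_sign_sample by simp
  have "real (card F) = (2 * real m) ^ d" by (simp add: F_def card_PiE)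
  have "(\<Sum>f\<in>F. if sample m d f z = 0 then 1 else 1/16)
      = (\<Sum>f\<in>F. 17/32 + 15/32 * bit_sign (sample m d f z))"
    by (intro sum.cong) (auto simp: bit_sign_def)
  also have "\<dots> = 17/32 * (2 * real m) ^ d + 15/32 * (\<Sum>f\<in>F. bit_sign (sample m d f z))"
    by (simp add: sum.distrib sum_distrib_left \<open>real (card F) = _\<close>)
  also have "\<dots> \<le> 49/64 * (2 * real m) ^ d" using s by linarith
  finally show ?thesis unfolding F_def .
qed

text \<open>Weight amplification: sparse random parity checks bring all of \<open>Z\<close> to the
  same weight whatever \<beta> is; only \<open>d\<close> depends on \<beta>. The proof is a Chernoff
  bound for each vector and a union bound over fewer than 2^K of them.\<close>

lemma exists_good_samples:
  assumes "finite Z" "card Z < 2 ^ K" "m > 0"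
    and Z: "\<And>z. z \<in> Z \<Longrightarrow> \<beta> * real m \<le> real (hweight m z)" and d: "(1 - \<beta>) ^ d \<le> 1/2"
  shows "\<exists>F. \<forall>z\<in>Z. K < 2 * hweight (8 * K) (\<lambda>j. sample m d (F j) z)"
proof -
  define X where "X = PiE {..<d} (\<lambda>_. {..<2 * m})"
  define \<Omega> where "\<Omega> = PiE {..<8 * K} (\<lambda>_. X)"
  have fin: "finite X" "finite \<Omega>" by (auto simp: X_def \<Omega>_def intro!: finite_PiE)
  have card_\<Omega>: "real (card \<Omega>) = ((2 * real m) ^ d) ^ (8 * K)"
    by (simp add: \<Omega>_def X_def card_PiE)
  define bad where "bad z F \<longleftrightarrow> 2 * hweight (8 * K) (\<lambda>j. sample m d (F j) z) \<le> K" for z F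
  have bad: "real (card {F\<in>\<Omega>. bad z F}) \<le> (1/2) ^ K * real (card \<Omega>)" if "z \<in> Z" for z
  proof -
    \<comment> \<open>Markov's inequality for 16^-weight: a weight of at most K / 2 means a value of
      at least 4^-K.\<close>
    have "real (card {F\<in>\<Omega>. bad z F}) * (1/4) ^ K = (\<Sum>F\<in>{F\<in>\<Omega>. bad z F}. (1/4) ^ K)" by simp
    also have "\<dots> \<le> (\<Sum>F\<in>{F\<in>\<Omega>. bad z F}. (1/16) ^ hweight (8 * K) (\<lambda>j. sample m d (F j) z))"
    proof (intro sum_mono)
      fix F assume "F \<in> {F\<in>\<Omega>. bad z F}"
      then have "(1/4::real) ^ K \<le> (1/4) ^ (2 * hweight (8 * K) (\<lambda>j. sample m d (F j) z))"
        unfolding bad_def by (intro power_decreasing) auto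
      then show "(1/4::real) ^ K \<le> (1/16) ^ hweight (8 * K) (\<lambda>j. sample m d (F j) z)"
        by (simp add: power_mult power2_eq_square)
    qed
    also have "\<dots> \<le> (\<Sum>F\<in>\<Omega>. (1/16) ^ hweight (8 * K) (\<lambda>j. sample m d (F j) z))"
      using fin by (intro sum_mono2) auto
    also have "\<dots> = (\<Sum>F\<in>\<Omega>. \<Prod>j<8 * K. if sample m d (F j) z = 0 then 1 else 1/16)"
      by (simp only: prod_hweight)
    also have "\<dots> = (\<Prod>j<8 * K. \<Sum>f\<in>X. if sample m d f z = 0 then 1 else 1/16)"
      unfolding \<Omega>_def using fin by (intro prod_sum_PiE[symmetric]) auto
    also have "\<dots> = (\<Sum>f\<in>X. if sample m d f z = 0 then 1 else 1/16) ^ (8 * K)"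
      by simp
    also have "\<dots> \<le> (49/64 * (2 * real m) ^ d) ^ (8 * K)"
      unfolding X_def by (intro power_mono sum_sample_le[OF Z[OF that] d] sum_nonneg) auto
    also have "\<dots> = ((49/64) ^ 8) ^ K * real (card \<Omega>)"
      by (simp only: card_\<Omega> power_mult_distrib power_mult)
    \<comment> \<open>As (49/64)^8 < 1/8, eight rows per dimension suffice: a factor 4 pays for
      Markov's inequality and a factor 2 for the union bound.\<close>
    also have "\<dots> \<le> (1/8) ^ K * real (card \<Omega>)"
      by (intro mult_right_mono power_mono) (auto simp: eval_nat_numeral)
    also have "(1/8::real) ^ K = (1/2) ^ K * (1/4) ^ K" by (simp flip: power_mult_distrib)
    finally show ?thesis by (simp add: field_simps)
  qed
  have "(\<Sum>z\<in>Z. real (card {F\<in>\<Omega>. bad z F})) \<le> (\<Sum>z\<in>Z. (1/2) ^ K * real (card \<Omega>))"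
    by (intro sum_mono bad)
  also have "\<dots> = real (card Z) / 2 ^ K * real (card \<Omega>)" by (simp add: power_one_over field_simps)
  also have "\<dots> < 1 * real (card \<Omega>)"
  proof (intro mult_strict_right_mono)
    have "real (card Z) < 2 ^ K" using assms(2) by (metis of_nat_less_iff of_nat_numeral of_nat_power)
    then show "real (card Z) / 2 ^ K < 1" by simp
    show "0 < real (card \<Omega>)" using assms(3) by (simp only: card_\<Omega>) simp
  qed
  finally obtain F where "\<forall>z\<in>Z. \<not> bad z F"
    using exists_avoiding_all[OF fin(2) assms(1), of bad] by auto
  then show ?thesis by (intro exI[of _ F]) (auto simp: bad_def not_le)
qed

text \<open>A uniform pair of positions misses the product of two supports with probability at most
  1 - \<beta>^2, independently for the \<open>L\<close> pairs, and there are |Z|^2 products to hit.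
  One fixed choice of positions thus serves all pairs of codewords.\<close>

lemma exists_hitting_pairs:
  assumes "finite Z" and Z: "\<And>z. z \<in> Z \<Longrightarrow> \<beta> * real m \<le> real (hweight m z)"
    and "\<beta> \<ge> 0" "m > 0" "(1 - \<beta>\<^sup>2) ^ L * real (card Z) ^ 2 < 1"
  shows "\<exists>p q. (\<forall>l<L. p l < m \<and> q l < m) \<and> (\<forall>u\<in>Z. \<forall>v\<in>Z. \<exists>l<L. u (p l) \<noteq> 0 \<and> v (q l) \<noteq> (0::bit))"
proof -
  define \<Omega> where "\<Omega> = PiE {..<L} (\<lambda>_. {..<m} \<times> {..<m})"
  have fin: "finite \<Omega>" by (auto simp: \<Omega>_def intro!: finite_PiE)
  have card_\<Omega>: "real (card \<Omega>) = (real m * real m) ^ L" by (simp add: \<Omega>_def card_PiE)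
  define bad where "bad = (\<lambda>(u :: nat \<Rightarrow> bit, v :: nat \<Rightarrow> bit) g. \<forall>l<L. \<not> (u (fst (g l)) \<noteq> 0 \<and> v (snd (g l)) \<noteq> (0::bit)))"
  have bad: "real (card {g\<in>\<Omega>. bad (u, v) g}) \<le> (1 - \<beta>\<^sup>2) ^ L * real (card \<Omega>)"
    if "u \<in> Z" "v \<in> Z" for u v
  proof -
    define U where "U = {i\<in>{..<m}. u i \<noteq> 0}"
    define V where "V = {i\<in>{..<m}. v i \<noteq> 0}"
    have "{g\<in>\<Omega>. bad (u, v) g} \<subseteq> PiE {..<L} (\<lambda>_. {..<m} \<times> {..<m} - U \<times> V)"
      by (auto simp: \<Omega>_def bad_def U_def V_def intro!: PiE_I dest: PiE_mem PiE_arb)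
    then have "card {g\<in>\<Omega>. bad (u, v) g} \<le> card (PiE {..<L} (\<lambda>_. {..<m} \<times> {..<m} - U \<times> V))"
      by (intro card_mono finite_PiE) auto
    also have "\<dots> = card ({..<m} \<times> {..<m} - U \<times> V) ^ L" by (simp add: card_PiE)
    finally have "real (card {g\<in>\<Omega>. bad (u, v) g}) \<le> real (card ({..<m} \<times> {..<m} - U \<times> V)) ^ L"
      by (simp only: of_nat_le_iff flip: of_nat_power)
    also have "\<dots> \<le> ((1 - \<beta>\<^sup>2) * (real m * real m)) ^ L"
    proof (intro power_mono)
      have UV: "\<beta> * real m \<le> real (card U)" "\<beta> * real m \<le> real (card V)"
        using Z that by (auto simp: hweight_def U_def V_def)
      have "U \<times> V \<subseteq> {..<m} \<times> {..<m}" by (auto simp: U_def V_def)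
      moreover from this have "card (U \<times> V) \<le> m * m"
        using card_mono[of "{..<m} \<times> {..<m}" "U \<times> V"] by simp
      ultimately have "real (card ({..<m} \<times> {..<m} - U \<times> V)) = real m * real m - real (card U) * real (card V)"
        by (subst card_Diff_subset) (auto simp: U_def V_def of_nat_diff card_cartesian_product)
      moreover have "(\<beta> * real m) * (\<beta> * real m) \<le> real (card U) * real (card V)"
        using assms(3) by (intro mult_mono UV) auto
      ultimately show "real (card ({..<m} \<times> {..<m} - U \<times> V)) \<le> (1 - \<beta>\<^sup>2) * (real m * real m)"
        by (simp add: algebra_simps power2_eq_square)
    qed auto
    also have "\<dots> = (1 - \<beta>\<^sup>2) ^ L * real (card \<Omega>)" by (simp only: card_\<Omega> power_mult_distrib)
    finally show ?thesis .
  qed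
  have "(\<Sum>uv\<in>Z \<times> Z. real (card {g\<in>\<Omega>. bad uv g})) \<le> (\<Sum>uv\<in>Z \<times> Z. (1 - \<beta>\<^sup>2) ^ L * real (card \<Omega>))"
    by (intro sum_mono) (auto intro: bad)
  also have "\<dots> = ((1 - \<beta>\<^sup>2) ^ L * real (card Z) ^ 2) * real (card \<Omega>)"
    by (simp add: power2_eq_square card_cartesian_product)
  also have "\<dots> < 1 * real (card \<Omega>)"
    using assms(4,5) by (intro mult_strict_right_mono) (auto simp: card_\<Omega>)
  finally obtain g where g: "g \<in> \<Omega>" "\<forall>uv\<in>Z \<times> Z. \<not> bad uv g"
    using exists_avoiding_all[OF fin, of "Z \<times> Z" bad] assms(1) by auto
  then have "\<forall>l<L. fst (g l) < m \<and> snd (g l) < m"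
    by (auto simp: \<Omega>_def PiE_iff mem_Times_iff)
  moreover have "\<forall>u\<in>Z. \<forall>v\<in>Z. \<exists>l<L. u (fst (g l)) \<noteq> 0 \<and> v (snd (g l)) \<noteq> 0"
    using g(2) by (auto simp: bad_def)
  ultimately show ?thesis
    by (intro exI[of _ "\<lambda>l. fst (g l)"] exI[of _ "\<lambda>l. snd (g l)"] conjI)
qed

section \<open>Good codes with linear-size encoders and transposed encoders\<close>

lemma UNIV_bit: "(UNIV :: bit set) = {0, 1}"
  by (auto intro: bit.exhaust)

text \<open>Extensional functions give each vector exactly one representative, so cardinalities
  count vectors.\<close>

definition bit_vectors :: "nat \<Rightarrow> (nat \<Rightarrow> bit) set" where
  "bit_vectors k = PiE {..<k} (\<lambda>_. UNIV)"

lemma finite_bit_vectors [simp]: "finite (bit_vectors k)"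
  by (simp add: bit_vectors_def finite_PiE UNIV_bit)

lemma card_bit_vectors: "card (bit_vectors k) = 2 ^ k"
  by (simp add: bit_vectors_def card_PiE UNIV_bit numeral_2_eq_2)

lemma restrict_in_bit_vectors: "restrict x {..<k} \<in> bit_vectors k"
  by (simp add: bit_vectors_def)

lemma mat_app_cong: "(\<And>i. i < k \<Longrightarrow> x i = y i) \<Longrightarrow> mat_app k A x j = mat_app k A y j"
  unfolding mat_app_def by (intro sum.cong) auto

lemma mat_app_restrict: "mat_app k A (restrict x {..<k}) = mat_app k A x"
  by (intro ext mat_app_cong) simp

lemma hweight_cong: "(\<And>i. i < k \<Longrightarrow> x i = y i) \<Longrightarrow> hweight k x = hweight k y"
  unfolding hweight_def by (intro arg_cong[of _ _ card]) auto

definition nonzero_bit_vectors :: "nat \<Rightarrow> (nat \<Rightarrow> bit) set" where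
  "nonzero_bit_vectors k = {x \<in> bit_vectors k. \<exists>i<k. x i \<noteq> 0}"

lemma finite_nonzero_bit_vectors [simp]: "finite (nonzero_bit_vectors k)"
  by (simp add: nonzero_bit_vectors_def)

lemma card_nonzero_bit_vectors: "card (nonzero_bit_vectors k) < 2 ^ k"
proof -
  have "restrict (\<lambda>_. 0) {..<k} \<in> bit_vectors k - nonzero_bit_vectors k"
    by (simp add: restrict_in_bit_vectors nonzero_bit_vectors_def)
  then have "nonzero_bit_vectors k \<subset> bit_vectors k" unfolding nonzero_bit_vectors_def by blast
  then show ?thesis using psubset_card_mono[OF finite_bit_vectors] card_bit_vectors by metis
qed

lemma hweight_add:
  "hweight (k + m) v = hweight k v + hweight m (\<lambda>j. v (k + j))"
proof -
  have "{i\<in>{..<k + m}. v i \<noteq> 0} = {i\<in>{..<k}. v i \<noteq> 0} \<union> (+) k ` {j\<in>{..<m}. v (k + j) \<noteq> 0}"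
  proof (rule Set.set_eqI)
    fix i show "i \<in> {i\<in>{..<k + m}. v i \<noteq> 0} \<longleftrightarrow>
      i \<in> {i\<in>{..<k}. v i \<noteq> 0} \<union> (+) k ` {j\<in>{..<m}. v (k + j) \<noteq> 0}"
      by (cases "i < k") (auto simp: image_iff less_diff_conv2 intro!: exI[of _ "i - k"])
  qed
  then show ?thesis unfolding hweight_def
    by (simp only:, subst card_Un_disjoint) (auto simp: card_image)
qed

lemma hweight_systematic:
  "hweight (k + m) (mat_app k (systematic k A) x) = hweight k x + hweight m (mat_app k A x)"
  unfolding hweight_add by (intro arg_cong2[of _ _ _ _ "(+)"] hweight_cong) (simp_all add: mat_app_systematic)

text \<open>Otherwise every fibre would have at least two elements. Applied to the edges leaving a
  small set, this yields a unique neighbour.\<close>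

lemma exists_unique_preimage:
  assumes "finite A" "card A < 2 * card (f ` A)"
  shows "\<exists>a\<in>A. \<forall>b\<in>A. f b = f a \<longrightarrow> b = a"
proof (rule ccontr)
  assume *: "\<not> ?thesis"
  have "2 \<le> card {a\<in>A. f a = y}" if y: "y \<in> f ` A" for y
  proof -
    obtain a b where "a \<in> A" "f a = y" "b \<in> A" "f b = y" "b \<noteq> a" using y * by blast
    then have "card {a, b} \<le> card {a\<in>A. f a = y}" using assms(1) by (intro card_mono) auto
    then show ?thesis using \<open>b \<noteq> a\<close> by simp
  qed
  then have "(\<Sum>y\<in>f ` A. 2) \<le> (\<Sum>y\<in>f ` A. card {a\<in>A. f a = y})" by (intro sum_mono)
  also have "\<dots> = card A" using sum.image_gen[OF assms(1), of "\<lambda>_. 1 :: nat" f] by simp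
  finally show False using assms(2) by simp
qed

lemma sum_single:
  assumes "finite A" "a \<in> A" "\<And>b. b \<in> A \<Longrightarrow> b \<noteq> a \<Longrightarrow> h b = 0"
  shows "sum h A = (h a :: 'b::comm_monoid_add)"
proof -
  have "sum h A = sum h {a}" using assms by (intro sum.mono_neutral_right) auto
  then show ?thesis by simp
qed

lemma sum_select_row:
  fixes c :: "nat \<times> nat \<Rightarrow> 'b::comm_semiring_1"
  assumes "j < L"
  shows "(\<Sum>l\<in>{..<L} \<times> {..<d}. c l * of_bool (fst l = j) * x l) = (\<Sum>e<d. c (j, e) * x (j, e))"
proof -
  have "(\<Sum>l\<in>{..<L} \<times> {..<d}. c l * of_bool (fst l = j) * x l)
      = (\<Sum>i<L. \<Sum>e<d. c (i, e) * of_bool (i = j) * x (i, e))"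
    by (simp add: sum.cartesian_product case_prod_unfold)
  also have "\<dots> = (\<Sum>e<d. c (j, e) * of_bool (j = j) * x (j, e))"
    using assms by (intro sum_single) auto
  finally show ?thesis by simp
qed

text \<open>The distance does not decay along the recursion: a heavy message is heavy in its
  systematic part, and for a light one it suffices that R x is nonzero, since \<open>B\<close> then
  restores a weight above K / 2 from the bare distance guarantee of the inner code. As the dimension
  shrinks by a constant factor, the costs form a geometric series.\<close>

lemma exists_good_code:
  "\<exists>s. \<forall>k>0. \<exists>m G. m > 0 \<and> m \<le> 9 * k \<and> lin_cost k m G (s * k) \<and> lin_cost m k (mat_transp G) (s * k) \<and>
     (\<forall>x. (\<exists>i<k. x i \<noteq> 0) \<longrightarrow> k \<le> 1728 * hweight m (mat_app k G x))"
proof -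
  \<comment> \<open>15552 = 9 * 1728: a weight of at least K / 1728 in length at most 9 K is a
    relative weight of at least 1 / 15552.\<close>
  have "\<exists>d. (1 - 1 / 15552 :: real) ^ d < 1/2" by (intro real_arch_pow_inv) auto
  then obtain d where d: "(1 - 1 / 15552 :: real) ^ d \<le> 1/2" by (auto dest: less_imp_le)
  \<comment> \<open>\<open>C * k\<close> bounds the gates outside the recursive call; since 4 K <= 3
    k, the total \<open>4 * C * k\<close> reproduces itself.\<close>
  define C where "C = 7 + 8 * d"
  have "\<exists>m G. m > 0 \<and> m \<le> 9 * k \<and> lin_cost k m G (4 * C * k) \<and> lin_cost m k (mat_transp G) (4 * C * k) \<and>
     (\<forall>x. (\<exists>i<k. x i \<noteq> 0) \<longrightarrow> k \<le> 1728 * hweight m (mat_app k G x))" if "k > 0" for k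
    using that
  proof (induction k rule: less_induct)
    case (less k)
    show ?case
    proof (cases "k = 1")
      case True
      define G :: "nat \<Rightarrow> nat \<Rightarrow> bit" where "G = incidence {0::nat} (\<lambda>_. 1) id id"
      have app: "mat_app 1 G x 0 = x 0" for x
        unfolding G_def using sum_single[of "{0::nat}" 0 "\<lambda>l. 1 * of_bool (id l = 0) * x (id l)"]
        by (subst mat_app_incidence) simp_all
      have "lin_cost 1 1 G (Suc (card {0::nat}))" unfolding G_def
        by (rule lin_cost_incidence) auto
      then have cost: "lin_cost 1 1 G (4 * C * 1)" by (rule lin_cost_mono) (simp add: C_def)
      have "mat_transp G = G" by (simp add: G_def mat_transp_incidence)
      moreover have "hweight 1 (mat_app 1 G x) = 1" if "x 0 \<noteq> 0" for x
      proof -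
        have "{i\<in>{..<1}. mat_app 1 G x i \<noteq> 0} = {0::nat}" using that app[of x] by auto
        then show ?thesis by (simp add: hweight_def)
      qed
      ultimately show ?thesis using cost True by (intro exI[of _ "1::nat"] exI[of _ G]) auto
    next
      case False
      define K where "K = (k + 1) div 2"
      have K: "K < k" "K > 0" "k \<le> 2 * K" "4 * K \<le> 3 * k" "8 * K \<le> 4 * k + 4" "2 \<le> k"
        using False less.prems by (auto simp: K_def)
      obtain m' G' where G': "m' > 0" "m' \<le> 9 * K" "lin_cost K m' G' (4 * C * K)"
        "lin_cost m' K (mat_transp G') (4 * C * K)"
        and wt: "\<forall>x. (\<exists>i<K. x i \<noteq> 0) \<longrightarrow> K \<le> 1728 * hweight m' (mat_app K G' x)"
        using less.IH[OF K(1,2)] by (elim exE conjE)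
      obtain f where f: "\<forall>i<k. \<forall>e<4. f (i, e) < K"
        "\<forall>S\<subseteq>{..<k}. S \<noteq> {} \<longrightarrow> 1728 * card S \<le> k \<longrightarrow> 2 * card S < card (f ` (S \<times> {..<4::nat}))"
        using exists_sparse_expander[OF K(3,2)] by (elim exE conjE)
      define Z where "Z = mat_app K G' ` nonzero_bit_vectors K"
      have Z: "finite Z" "card Z < 2 ^ K"
        unfolding Z_def using card_image_le[OF finite_nonzero_bit_vectors, of "mat_app K G'" K]
          card_nonzero_bit_vectors[of K] by auto
      have "1 / 15552 * real m' \<le> real (hweight m' z)" if "z \<in> Z" for z
      proof -
        have "K \<le> 1728 * hweight m' z" using that wt by (auto simp: Z_def nonzero_bit_vectors_def)
        then have "m' \<le> 15552 * hweight m' z" using G'(2) by linarith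
        then have "real m' \<le> real (15552 * hweight m' z)" by (rule of_nat_mono)
        then show ?thesis by simp
      qed
      then obtain F where F: "\<forall>z\<in>Z. K < 2 * hweight (8 * K) (\<lambda>j. sample m' d (F j) z)"
        using exists_good_samples[OF Z G'(1) _ d] by metis
      \<comment> \<open>The adjacency matrix of the expander. Parallel edges cancel modulo 2, which
        is harmless because uniqueness below is among edges.\<close>
      define R :: "nat \<Rightarrow> nat \<Rightarrow> bit" where "R = incidence ({..<k} \<times> {..<4::nat}) (\<lambda>_. 1) f fst"
      \<comment> \<open>Dummy samples become entries with coefficient 0 in column 0, which keeps all
        column indices in range.\<close>
      define c :: "nat \<times> nat \<Rightarrow> bit" where "c = (\<lambda>(j, e). of_bool (F j e < m'))"
      define q where "q = (\<lambda>(j, e). if F j e < m' then F j e else 0)"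
      have q: "q l < m'" for l using G'(1) by (simp add: q_def case_prod_unfold)
      define B :: "nat \<Rightarrow> nat \<Rightarrow> bit" where "B = incidence ({..<8 * K} \<times> {..<d}) c fst q"
      have app_B: "mat_app m' B z j = sample m' d (F j) z" if "j < 8 * K" for z j
      proof -
        have "mat_app m' B z j = (\<Sum>e<d. c (j, e) * z (q (j, e)))"
          unfolding B_def using q sum_select_row[OF that, of c "\<lambda>l. z (q l)" d]
          by (subst mat_app_incidence) auto
        also have "\<dots> = sample m' d (F j) z"
          unfolding sample_def by (intro sum.cong) (auto simp: c_def q_def)
        finally show ?thesis .
      qed
      define H where "H = mat_prod m' B (mat_prod K G' R)"
      define G where "G = systematic k H"
      have R_cost: "lin_cost k K R (Suc (4 * k))" "lin_cost K k (mat_transp R) (Suc (4 * k))"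
        unfolding R_def mat_transp_incidence
        by (rule lin_cost_incidence[THEN lin_cost_mono]; use f(1) in force)+
      have B_cost: "lin_cost m' (8 * K) B (Suc (8 * K * d))" "lin_cost (8 * K) m' (mat_transp B) (Suc (8 * K * d))"
        unfolding B_def mat_transp_incidence
        by (rule lin_cost_incidence[THEN lin_cost_mono]; use q in force)+
      have le: "Suc (4 * k) + 4 * C * K + Suc (8 * K * d) + k \<le> 4 * C * k"
      proof -
        have "C * (4 * K) \<le> C * (3 * k)" by (rule mult_le_mono2[OF K(4)])
        moreover have "K * d \<le> k * d" using K(1) by (intro mult_le_mono) auto
        moreover have "C * k = 7 * k + 8 * (k * d)" by (simp add: C_def algebra_simps)
        ultimately show ?thesis using K(6) by linarith
      qed
      have "lin_cost k (8 * K) H (Suc (4 * k) + 4 * C * K + Suc (8 * K * d))"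
        unfolding H_def by (intro lin_cost_prod R_cost G' B_cost)
      then have cost: "lin_cost k (k + 8 * K) G (4 * C * k)"
        unfolding G_def by (rule lin_cost_systematic[THEN lin_cost_mono]) (use le in linarith)
      have "lin_cost (8 * K) k (mat_transp H) (Suc (8 * K * d) + (4 * C * K + Suc (4 * k)))"
        unfolding H_def mat_transp_prod
        by (intro lin_cost_prod R_cost G' B_cost)
      then have cost_t: "lin_cost (k + 8 * K) k (mat_transp G) (4 * C * k)"
        unfolding G_def by (rule lin_cost_transp_systematic[THEN lin_cost_mono]) (use le in linarith)
      have "k \<le> 1728 * hweight (k + 8 * K) (mat_app k G x)" if x: "\<exists>i<k. x i \<noteq> 0" for x
      proof (cases "k \<le> 1728 * hweight k x")
        case True
        then show ?thesis unfolding G_def hweight_systematic by simp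
      next
        case light: False
        define S where "S = {i\<in>{..<k}. x i \<noteq> 0}"
        have S: "S \<subseteq> {..<k}" "S \<noteq> {}" "1728 * card S \<le> k" "finite S"
          using x light by (auto simp: S_def hweight_def)
        \<comment> \<open>The endpoints outnumber half of the edges leaving the support, so some
          edge ends alone, and R x is nonzero at its endpoint.\<close>
        then have "2 * card S < card (f ` (S \<times> {..<4::nat}))" using f(2) by blast
        then have "\<exists>l\<in>S \<times> {..<4::nat}. \<forall>b\<in>S \<times> {..<4}. f b = f l \<longrightarrow> b = l"
          using S(4) by (intro exists_unique_preimage) (auto simp: card_cartesian_product)
        then obtain l where l: "l \<in> S \<times> {..<4::nat}" "\<And>b. b \<in> S \<times> {..<4} \<Longrightarrow> f b = f l \<Longrightarrow> b = l"
          by blast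
        have "mat_app k R x (f l) = (\<Sum>b\<in>{..<k} \<times> {..<4::nat}. 1 * of_bool (f b = f l) * x (fst b))"
          unfolding R_def by (subst mat_app_incidence) auto
        also have "\<dots> = 1 * of_bool (f l = f l) * x (fst l)"
        proof (rule sum_single)
          fix b assume b: "b \<in> {..<k} \<times> {..<4::nat}" "b \<noteq> l"
          have "x (fst b) = 0" if "f b = f l"
          proof (rule ccontr)
            assume "x (fst b) \<noteq> 0"
            then have "b \<in> S \<times> {..<4}" using b(1) by (auto simp: S_def)
            then show False using l(2) that b(2) by blast
          qed
          then show "1 * of_bool (f b = f l) * x (fst b) = 0" by (cases "f b = f l") simp_all
        qed (use l(1) S(1) in auto)
        also have "\<dots> \<noteq> 0" using l(1) by (auto simp: S_def)
        finally have Rx: "mat_app k R x (f l) \<noteq> 0" .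
        define y where "y = restrict (mat_app k R x) {..<K}"
        have "f l < K" using l(1) S(1) f(1) by auto
        then have "y \<in> nonzero_bit_vectors K"
          using Rx by (auto simp: nonzero_bit_vectors_def y_def restrict_in_bit_vectors)
        then have "mat_app K G' y \<in> Z" unfolding Z_def by (rule imageI)
        then have "K < 2 * hweight (8 * K) (\<lambda>j. sample m' d (F j) (mat_app K G' y))" using F by blast
        also have "hweight (8 * K) (\<lambda>j. sample m' d (F j) (mat_app K G' y)) = hweight (8 * K) (mat_app k H x)"
        proof (rule hweight_cong)
          fix j assume "j < 8 * K"
          moreover have "mat_app K G' y = mat_app k (mat_prod K G' R) x"
            by (simp add: fun_eq_iff y_def mat_app_restrict mat_app_prod)
          ultimately show "sample m' d (F j) (mat_app K G' y) = mat_app k H x j"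
            unfolding H_def mat_app_prod[of k m' B] by (simp only: app_B)
        qed
        finally have heavy: "K < 2 * hweight (8 * K) (mat_app k H x)" .
        have "k \<le> 2 * K" by (rule K(3))
        also have "2 * K \<le> 4 * hweight (8 * K) (mat_app k H x)" using heavy by simp
        also have "\<dots> \<le> 1728 * (hweight k x + hweight (8 * K) (mat_app k H x))"
          by (intro mult_le_mono) auto
        finally show ?thesis unfolding G_def hweight_systematic .
      qed
      then show ?thesis using cost cost_t K(5,6)
        by (intro exI[of _ "k + 8 * K"] exI[of _ G]) auto
    qed
  qed
  then show ?thesis by (intro exI[of _ "4 * C"]) simp
qed

section \<open>A uniformly distributed family of linear maps\<close>

text \<open>Orthogonality of characters: a coordinate with \<open>v i \<noteq> 0\<close> contributes
  the factor 1 - 1 = 0.\<close>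

lemma sum_bit_sign_inner:
  "(\<Sum>y\<in>bit_vectors k. bit_sign (\<Sum>i<k. y i * v i)) = (if \<forall>i<k. v i = 0 then 2 ^ k else 0)"
proof -
  have "(\<Sum>y\<in>bit_vectors k. bit_sign (\<Sum>i<k. y i * v i)) = (\<Sum>y\<in>bit_vectors k. \<Prod>i<k. bit_sign (y i * v i))"
    by (simp only: bit_sign_sum)
  also have "\<dots> = (\<Prod>i<k. \<Sum>b\<in>UNIV. bit_sign (b * v i))"
    unfolding bit_vectors_def by (rule prod_sum_PiE[symmetric]) (auto simp: UNIV_bit)
  also have "\<dots> = (\<Prod>i<k. if v i = 0 then 2 else 0)"
    by (intro prod.cong) (auto simp: UNIV_bit bit_sign_def)
  finally show ?thesis by auto
qed

lemma bilinear_dual: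
  fixes A :: "nat \<Rightarrow> nat \<Rightarrow> 'b::comm_semiring_1"
  shows "(\<Sum>i<k. y i * mat_app m (mat_transp A) z i) = (\<Sum>j<m. mat_app k A y j * z j)"
proof -
  have "(\<Sum>i<k. y i * mat_app m (mat_transp A) z i) = (\<Sum>i<k. \<Sum>j<m. A j i * y i * z j)"
    by (simp add: mat_app_def mat_transp_def sum_distrib_left mult_ac)
  also have "\<dots> = (\<Sum>j<m. \<Sum>i<k. A j i * y i * z j)" by (rule sum.swap)
  finally show ?thesis by (simp add: mat_app_def sum_distrib_right)
qed

text \<open>The matrix G^T M G, where \<open>M\<close> lists the entries placed at the fixed
  positions given by \<open>p\<close> and \<open>q\<close>.\<close>

definition sandwich :: "nat \<Rightarrow> (nat \<Rightarrow> nat \<Rightarrow> 'b) \<Rightarrow> nat \<Rightarrow> (nat \<Rightarrow> nat) \<Rightarrow> (nat \<Rightarrow> nat) \<Rightarrow> (nat \<Rightarrow> 'b) \<Rightarrow>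
    nat \<Rightarrow> nat \<Rightarrow> 'b::comm_semiring_1" where
  "sandwich m G L p q M = mat_prod m (mat_transp G) (mat_prod m (incidence {..<L} M p q) G)"

lemma mat_prod_assoc: "mat_prod m (mat_prod l C B) A = mat_prod l C (mat_prod m B A)"
proof (intro ext)
  fix j i
  have "mat_prod m (mat_prod l C B) A j i = (\<Sum>r<m. \<Sum>t<l. C j t * B t r * A r i)"
    by (simp add: mat_prod_def sum_distrib_right)
  also have "\<dots> = (\<Sum>t<l. \<Sum>r<m. C j t * B t r * A r i)" by (rule sum.swap)
  finally show "mat_prod m (mat_prod l C B) A j i = mat_prod l C (mat_prod m B A) j i"
    by (simp add: mat_prod_def sum_distrib_left mult_ac)
qed

lemma mat_transp_transp [simp]: "mat_transp (mat_transp A) = A"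
  by (simp add: fun_eq_iff mat_transp_def)

text \<open>Since transposition merely exchanges \<open>p\<close> and \<open>q\<close>, the dual
  code comes under the same counting and the same cost bound.\<close>

lemma mat_transp_sandwich: "mat_transp (sandwich m G L p q M) = sandwich m G L q p M"
  by (simp add: sandwich_def mat_transp_prod mat_transp_incidence mat_prod_assoc)

lemma sandwich_form:
  assumes "\<And>l. l < L \<Longrightarrow> p l < m \<and> q l < m"
  shows "(\<Sum>i<k. y i * mat_app k (sandwich m G L p q M) x i) =
    (\<Sum>l<L. M l * (mat_app k G y (p l) * mat_app k G x (q l)))"
proof -
  have "(\<Sum>i<k. y i * mat_app k (sandwich m G L p q M) x i)
      = (\<Sum>j<m. mat_app k G y j * mat_app m (incidence {..<L} M p q) (mat_app k G x) j)"
    unfolding sandwich_def mat_app_prod bilinear_dual ..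
  also have "\<dots> = (\<Sum>j<m. \<Sum>l<L. mat_app k G y j * (M l * of_bool (p l = j) * mat_app k G x (q l)))"
    using assms by (subst mat_app_incidence) (auto simp only: sum_distrib_left)
  also have "\<dots> = (\<Sum>l<L. \<Sum>j<m. mat_app k G y j * (M l * of_bool (p l = j) * mat_app k G x (q l)))"
    by (rule sum.swap)
  also have "\<dots> = (\<Sum>l<L. mat_app k G y (p l) * (M l * of_bool (p l = p l) * mat_app k G x (q l)))"
    using assms by (intro sum.cong refl sum_single) auto
  finally show ?thesis by (simp add: mult_ac)
qed

text \<open>Uniformity by Fourier analysis: for every nonzero y the form y^T A x is a nonzero linear
  form in \<open>M\<close>, so all nontrivial characters sum to zero and every value
  \<open>w\<close> has equally many preimages.\<close>

lemma card_fiber_sandwich: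
  fixes G :: "nat \<Rightarrow> nat \<Rightarrow> bit"
  assumes pq: "\<And>l. l < L \<Longrightarrow> p l < m \<and> q l < m"
    and hit: "\<And>y. y \<in> nonzero_bit_vectors k \<Longrightarrow> \<exists>l<L. mat_app k G y (p l) \<noteq> 0 \<and> mat_app k G x (q l) \<noteq> 0"
  shows "real (card {M\<in>bit_vectors L. \<forall>i<k. mat_app k (sandwich m G L p q M) x i = w i}) * 2 ^ k = 2 ^ L"
proof -
  define A where "A M = mat_app k (sandwich m G L p q M) x" for M
  define y0 :: "nat \<Rightarrow> bit" where "y0 = restrict (\<lambda>_. 0) {..<k}"
  have y0: "y0 \<in> bit_vectors k" "\<And>i. i < k \<Longrightarrow> y0 i = 0"
    by (simp_all add: y0_def restrict_in_bit_vectors)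
  have char: "(\<Sum>M\<in>bit_vectors L. bit_sign (\<Sum>i<k. y i * A M i)) = 0"
    if "y \<in> bit_vectors k" "y \<noteq> y0" for y
  proof -
    have "\<exists>i<k. y i \<noteq> 0"
    proof (rule ccontr)
      assume "\<not> ?thesis"
      then have "y = y0" using that(1) y0 by (intro PiE_ext[of y "{..<k}" "\<lambda>_. UNIV" y0]) (auto simp: bit_vectors_def)
      then show False using that(2) by simp
    qed
    then have "y \<in> nonzero_bit_vectors k" using that(1) unfolding nonzero_bit_vectors_def by blast
    then obtain l where "l < L" "mat_app k G y (p l) \<noteq> 0" "mat_app k G x (q l) \<noteq> 0"
      using hit by blast
    then have "\<not> (\<forall>l<L. mat_app k G y (p l) * mat_app k G x (q l) = 0)" by auto
    moreover have "(\<Sum>i<k. y i * A M i) = (\<Sum>l<L. M l * (mat_app k G y (p l) * mat_app k G x (q l)))" for M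
      unfolding A_def by (rule sandwich_form) (rule pq)
    ultimately show ?thesis by (simp only: sum_bit_sign_inner if_False)
  qed
  have split: "bit_sign (\<Sum>i<k. y i * (A M i + w i)) =
      bit_sign (\<Sum>i<k. y i * A M i) * bit_sign (\<Sum>i<k. y i * w i)" for y M
    by (simp only: distrib_left sum.distrib bit_sign_add)
  have eq0: "u + v = 0 \<longleftrightarrow> u = v" for u v :: bit by (cases u; cases v) simp_all
  have "real (card {M\<in>bit_vectors L. \<forall>i<k. A M i = w i}) * 2 ^ k
      = (\<Sum>M\<in>{M\<in>bit_vectors L. \<forall>i<k. A M i = w i}. 2 ^ k)" by simp
  \<comment> \<open>In characteristic 2 the equation reads \<open>A M i + w i = 0\<close>, and
    \<open>2 ^ k\<close> times its indicator is a sum over all characters.\<close>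
  also have "\<dots> = (\<Sum>M\<in>bit_vectors L. if \<forall>i<k. A M i + w i = 0 then 2 ^ k else 0)"
    unfolding eq0 by (rule sum.inter_filter) simp
  also have "\<dots> = (\<Sum>M\<in>bit_vectors L. \<Sum>y\<in>bit_vectors k. bit_sign (\<Sum>i<k. y i * (A M i + w i)))"
    by (simp only: sum_bit_sign_inner)
  also have "\<dots> = (\<Sum>y\<in>bit_vectors k. \<Sum>M\<in>bit_vectors L. bit_sign (\<Sum>i<k. y i * (A M i + w i)))"
    by (rule sum.swap)
  also have "\<dots> = (\<Sum>y\<in>bit_vectors k. (\<Sum>M\<in>bit_vectors L. bit_sign (\<Sum>i<k. y i * A M i)) *
      bit_sign (\<Sum>i<k. y i * w i))"
    by (simp only: split sum_distrib_right)
  \<comment> \<open>Only the trivial character \<open>y0\<close> survives.\<close>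
  also have "\<dots> = (\<Sum>M\<in>bit_vectors L. bit_sign (\<Sum>i<k. y0 i * A M i)) * bit_sign (\<Sum>i<k. y0 i * w i)"
    by (rule sum_single) (simp_all only: finite_bit_vectors y0(1) char mult_zero_left simp_thms not_False_eq_True)
  also have "\<dots> = 2 ^ L"
  proof -
    have "(\<Sum>i<k. y0 i * v i) = 0" for v using y0(2) by (intro sum.neutral) auto
    then show ?thesis by (simp add: card_bit_vectors)
  qed
  finally show ?thesis unfolding A_def .
qed

text \<open>A union bound over light pairs (x, y) with x nonzero: A x = y has probability exactly
  2^-k, and so has the same event for the transpose, whence the factor 2 in the hypothesis.\<close>

lemma exists_good_linear_map:
  "\<exists>s. \<forall>k>0. \<forall>t::real.
     2 * real (card {(x, y). x \<in> bit_vectors k \<and> y \<in> bit_vectors k \<and> real (hweight k x + hweight k y) < t}) < 2 ^ k \<longrightarrow>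
     (\<exists>A. lin_cost k k A (s * k) \<and> lin_cost k k (mat_transp A) (s * k) \<and>
       (\<forall>x. (\<exists>i<k. x i \<noteq> 0) \<longrightarrow> t \<le> real (hweight k x + hweight k (mat_app k A x)) \<and>
         t \<le> real (hweight k x + hweight k (mat_app k (mat_transp A) x))))"
proof -
  obtain s where s: "\<forall>k>0. \<exists>m G. m > 0 \<and> m \<le> 9 * k \<and> lin_cost k m G (s * k) \<and> lin_cost m k (mat_transp G) (s * k) \<and>
     (\<forall>x. (\<exists>i<k. x i \<noteq> 0) \<longrightarrow> k \<le> 1728 * hweight m (mat_app k G x))"
    using exists_good_code by (elim exE)
  define \<beta> :: real where "\<beta> = 1 / 15552"
  \<comment> \<open>At most 4^k pairs of codewords have to be hit, so \<open>c * k\<close> positions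
    suffice.\<close>
  have "\<exists>c. (1 - \<beta>\<^sup>2) ^ c < 1/4" by (intro real_arch_pow_inv) (auto simp: \<beta>_def)
  then obtain c where c: "(1 - \<beta>\<^sup>2) ^ c < 1/4" by blast
  have "\<exists>A. lin_cost k k A ((2 * s + c + 1) * k) \<and> lin_cost k k (mat_transp A) ((2 * s + c + 1) * k) \<and>
       (\<forall>x. (\<exists>i<k. x i \<noteq> 0) \<longrightarrow> t \<le> real (hweight k x + hweight k (mat_app k A x)) \<and>
         t \<le> real (hweight k x + hweight k (mat_app k (mat_transp A) x)))"
    if k: "k > 0" and t: "2 * real (card {(x, y). x \<in> bit_vectors k \<and> y \<in> bit_vectors k \<and>
      real (hweight k x + hweight k y) < t}) < 2 ^ k" for k and t :: real
  proof -
    obtain m G where G: "m > 0" "m \<le> 9 * k" "lin_cost k m G (s * k)" "lin_cost m k (mat_transp G) (s * k)"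
      and wt: "\<forall>x. (\<exists>i<k. x i \<noteq> 0) \<longrightarrow> k \<le> 1728 * hweight m (mat_app k G x)"
      using s[rule_format, OF k] by (elim exE conjE)
    define Z where "Z = mat_app k G ` nonzero_bit_vectors k"
    have Z: "finite Z" "card Z \<le> 2 ^ k"
      unfolding Z_def using card_image_le[OF finite_nonzero_bit_vectors, of "mat_app k G" k]
        card_nonzero_bit_vectors[of k] by auto
    have Z_wt: "\<beta> * real m \<le> real (hweight m z)" if "z \<in> Z" for z
    proof -
      have "k \<le> 1728 * hweight m z" using that wt by (auto simp: Z_def nonzero_bit_vectors_def)
      then have "m \<le> 15552 * hweight m z" using G(2) by linarith
      then have "real m \<le> real (15552 * hweight m z)" by (rule of_nat_mono)
      then show ?thesis by (simp add: \<beta>_def)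
    qed
    define L where "L = c * k"
    have "(1 - \<beta>\<^sup>2) ^ L * real (card Z) ^ 2 \<le> (1 - \<beta>\<^sup>2) ^ L * 4 ^ k"
    proof (intro mult_left_mono)
      have "real (card Z) \<le> 2 ^ k" using Z(2) by (metis of_nat_le_iff of_nat_numeral of_nat_power)
      then have "real (card Z) ^ 2 \<le> (2 ^ k) ^ 2" by (intro power_mono) auto
      then show "real (card Z) ^ 2 \<le> 4 ^ k" by (simp flip: power_mult add: power_mult mult.commute[of k])
    qed (intro zero_le_power, simp add: \<beta>_def power2_eq_square)
    also have "\<dots> = ((1 - \<beta>\<^sup>2) ^ c * 4) ^ k" by (simp add: L_def power_mult power_mult_distrib)
    also have "\<dots> < 1 ^ k" using c k by (intro power_strict_mono mult_nonneg_nonneg zero_le_power) (simp_all add: \<beta>_def power2_eq_square)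
    finally have "(1 - \<beta>\<^sup>2) ^ L * real (card Z) ^ 2 < 1" by simp
    then obtain p q where pq: "\<forall>l<L. p l < m \<and> q l < m"
      and hit: "\<forall>u\<in>Z. \<forall>v\<in>Z. \<exists>l<L. u (p l) \<noteq> 0 \<and> v (q l) \<noteq> 0"
      using exists_hitting_pairs[OF Z(1) Z_wt _ G(1), of L] by (auto simp: \<beta>_def)
    have hit': "\<exists>l<L. mat_app k G x (p l) \<noteq> 0 \<and> mat_app k G y (q l) \<noteq> 0"
      if "x \<in> nonzero_bit_vectors k" "y \<in> nonzero_bit_vectors k" for x y
      using hit that unfolding Z_def by blast
    define N where "N = {(x, y). x \<in> bit_vectors k \<and> y \<in> bit_vectors k \<and>
      real (hweight k x + hweight k y) < t}"
    \<comment> \<open>The flag tells the matrix from its transpose.\<close>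
    define I where "I = (UNIV :: bool set) \<times> {(x, y) \<in> N. x \<in> nonzero_bit_vectors k}"
    have fin: "finite N" by (rule finite_subset[of _ "bit_vectors k \<times> bit_vectors k"]) (auto simp: N_def)
    then have fin': "finite I" unfolding I_def by (intro finite_cartesian_product finite_subset[OF _ fin]) auto
    define A where "A = (\<lambda>b M. if b then sandwich m G L p q M else sandwich m G L q p M)"
    define bad where "bad = (\<lambda>(b, x, y :: nat \<Rightarrow> bit) M. \<forall>i<k. mat_app k (A b M) x i = y i)"
    have card_bad: "real (card {M\<in>bit_vectors L. bad (b, x, y) M}) = 2 ^ L / 2 ^ k"
      if "x \<in> nonzero_bit_vectors k" for b x y
    proof (cases b)
      case True
      have "real (card {M\<in>bit_vectors L. \<forall>i<k. mat_app k (sandwich m G L p q M) x i = y i}) * 2 ^ k = 2 ^ L"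
        using pq hit' that by (intro card_fiber_sandwich) auto
      then show ?thesis using True by (simp add: bad_def A_def field_simps)
    next
      case False
      \<comment> \<open>With \<open>p\<close> and \<open>q\<close> exchanged, the hitting property
        is used with the roles of the two vectors exchanged.\<close>
      have "real (card {M\<in>bit_vectors L. \<forall>i<k. mat_app k (sandwich m G L q p M) x i = y i}) * 2 ^ k = 2 ^ L"
        using pq hit'[OF that] by (intro card_fiber_sandwich) blast+
      then show ?thesis using False by (simp add: bad_def A_def field_simps)
    qed
    have "card {(x, y) \<in> N. x \<in> nonzero_bit_vectors k} \<le> card N" by (rule card_mono[OF fin]) auto
    then have "card I \<le> 2 * card N" unfolding I_def card_cartesian_product by simp
    have "(\<Sum>i\<in>I. real (card {M\<in>bit_vectors L. bad i M})) = (\<Sum>i\<in>I. 2 ^ L / 2 ^ k)"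
      by (intro sum.cong) (auto simp: I_def card_bad)
    also have "\<dots> = real (card I) * (2 ^ L / 2 ^ k)" by simp
    also have "\<dots> \<le> real (2 * card N) * (2 ^ L / 2 ^ k)"
      using \<open>card I \<le> _\<close> by (intro mult_right_mono of_nat_mono) auto
    also have "\<dots> < 2 ^ k * (2 ^ L / 2 ^ k)"
      using t unfolding N_def[symmetric] by (intro mult_strict_right_mono) auto
    also have "\<dots> = real (card (bit_vectors L))" by (simp add: card_bit_vectors)
    finally obtain M where M: "\<forall>i\<in>I. \<not> bad i M"
      using exists_avoiding_all[OF finite_bit_vectors fin', of L bad] by blast
    have dist: "t \<le> real (hweight k x + hweight k (mat_app k (A b M) x))"
      if "\<exists>i<k. x i \<noteq> 0" for b x
    proof (rule ccontr)
      define x' where "x' = restrict x {..<k}"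
      define y where "y = restrict (mat_app k (A b M) x) {..<k}"
      assume "\<not> ?thesis"
      then have "real (hweight k x' + hweight k y) < t"
        using hweight_cong[of k x' x] hweight_cong[of k y "mat_app k (A b M) x"]
        by (simp add: x'_def y_def)
      then have "(b, x', y) \<in> I"
        using that by (auto simp: I_def N_def nonzero_bit_vectors_def x'_def y_def restrict_in_bit_vectors)
      then have "\<not> bad (b, x', y) M" using M by blast
      then show False by (simp add: bad_def x'_def mat_app_restrict y_def)
    qed
    have cost: "lin_cost k k (sandwich m G L p' q' M) ((2 * s + c + 1) * k)"
      if "\<forall>l<L. q' l < m" for p' q'
    proof -
      have "lin_cost m m (incidence {..<L} M p' q') (Suc (card {..<L}))"
        using that by (intro lin_cost_incidence) auto
      then have "lin_cost k k (sandwich m G L p' q' M) (s * k + Suc (card {..<L}) + s * k)"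
        unfolding sandwich_def by (intro lin_cost_prod G)
      then show ?thesis by (rule lin_cost_mono) (use k in \<open>simp add: L_def algebra_simps\<close>)
    qed
    show ?thesis
      using cost[of q p] cost[of p q] pq dist[of _ True] dist[of _ False]
      by (intro exI[of _ "sandwich m G L p q M"]) (auto simp: mat_transp_sandwich A_def)
  qed
  then show ?thesis by (intro exI[of _ "2 * s + c + 1"]) blast
qed

section \<open>The entropy function and the volume bound\<close>

lemma binary_entropy_eq_ln:
  assumes "0 < x" "x < 1"
  shows "binary_entropy x = - (x * ln x + (1 - x) * ln (1 - x)) / ln 2"
  using assms by (simp add: binary_entropy_def log_def ln_div field_simps)

lemma binary_entropy_strict_mono:
  assumes "0 \<le> x" "x < y" "y \<le> 1/2"
  shows "binary_entropy x < binary_entropy y"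
\<comment> \<open>The derivative argument uses the logarithmic formula on positive arguments only.
  At 0 the entropy vanishes, while both of its summands at \<open>y\<close> are positive.\<close>
proof (cases "x = 0")
  case True
  have "y * log 2 (1 / y) > 0" "(1 - y) * log 2 (1 / (1 - y)) > 0"
    using assms True by (auto intro!: mult_pos_pos)
  then show ?thesis using True by (simp add: binary_entropy_def)
next
  case False
  have "(\<lambda>t. - (t * ln t + (1 - t) * ln (1 - t)) / ln 2) x < (\<lambda>t. - (t * ln t + (1 - t) * ln (1 - t)) / ln 2) y"
  proof (rule DERIV_pos_imp_increasing_open[OF assms(2)])
    fix t assume t: "x < t" "t < y"
    have "((\<lambda>t. - (t * ln t + (1 - t) * ln (1 - t))) has_real_derivative ln (1 - t) - ln t) (at t)"
      using t assms by (auto intro!: derivative_eq_intros)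
    then have "((\<lambda>t. - (t * ln t + (1 - t) * ln (1 - t)) / ln 2) has_real_derivative
        (ln (1 - t) - ln t) / ln 2) (at t)"
      by (rule DERIV_cdivide)
    moreover have "(ln (1 - t) - ln t) / ln 2 > 0" using t assms by (intro divide_pos_pos) auto
    ultimately show "\<exists>D. ((\<lambda>t. - (t * ln t + (1 - t) * ln (1 - t)) / ln 2) has_real_derivative D) (at t) \<and> D > 0"
      by blast
  qed (use assms False in \<open>auto intro!: continuous_intros\<close>)
  then show ?thesis using assms False by (simp add: binary_entropy_eq_ln)
qed

text \<open>\<open>the_inv_into\<close> is determined only on the image, so a preimage of 1/2 is
  first produced by the intermediate value theorem. The bound 1/16, from a crude entropy estimate,
  later leaves room for a positive distance.\<close>

lemma GV_distance_half:
  "binary_entropy (GV_distance (1/2)) = 1/2" "1/16 \<le> GV_distance (1/2)" "GV_distance (1/2) \<le> 1/2"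
proof -
  have "4 * log 2 (16/15) = log 2 ((16/15) ^ 4)" by (simp add: log_nat_power)
  also have "\<dots> \<le> log 2 2" by (subst log_le_cancel_iff) (auto simp: power4_eq_xxxx)
  finally have "log 2 (16/15 :: real) \<le> 1/4" by simp
  moreover have "log 2 (16 :: real) = 4" using log_pow_cancel[of 2 4] by simp
  ultimately have low: "binary_entropy (1/16) \<le> 1/2" by (simp add: binary_entropy_def)
  have high: "1/2 \<le> binary_entropy (1/2)" by (simp add: binary_entropy_def)
  have "continuous_on {1/16..1/2} binary_entropy"
    unfolding binary_entropy_def log_def by (intro continuous_intros) auto
  then obtain \<delta> where \<delta>: "1/16 \<le> \<delta>" "\<delta> \<le> 1/2" "binary_entropy \<delta> = 1/2"
    using IVT'[of binary_entropy "1/16" "1/2" "1/2", OF low high] by auto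
  have "inj_on binary_entropy {0..1/2}"
    by (rule linorder_inj_onI) (auto dest: binary_entropy_strict_mono)
  then have "GV_distance (1/2) = \<delta>"
    unfolding GV_distance_def inv_binary_entropy_def using \<delta> by (intro the_inv_into_f_eq) auto
  then show "binary_entropy (GV_distance (1/2)) = 1/2" "1/16 \<le> GV_distance (1/2)" "GV_distance (1/2) \<le> 1/2"
    using \<delta> by auto
qed

lemma sum_power_hweight: "(\<Sum>x\<in>bit_vectors k. (a :: real) ^ hweight k x) = (1 + a) ^ k"
proof -
  have "(\<Sum>x\<in>bit_vectors k. a ^ hweight k x) = (\<Sum>x\<in>bit_vectors k. \<Prod>i<k. if x i = 0 then 1 else a)"
    by (simp only: prod_hweight)
  also have "\<dots> = (\<Prod>i<k. \<Sum>b\<in>UNIV. if b = (0::bit) then 1 else a)"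
    unfolding bit_vectors_def by (rule prod_sum_PiE[symmetric]) (auto simp: UNIV_bit)
  finally show ?thesis by (simp add: UNIV_bit)
qed

text \<open>The entropy bound on the volume of a Hamming ball in dimension 2 k, with vectors split
  into halves as the codewords are.\<close>

lemma card_light_pairs_le:
  assumes "0 < \<delta>" "\<delta> < 1/2"
  shows "real (card {(x, y). x \<in> bit_vectors k \<and> y \<in> bit_vectors k \<and>
    real (hweight k x + hweight k y) < \<delta> * (2 * real k)}) \<le> 2 powr (binary_entropy \<delta> * (2 * real k))"
proof -
  define N where "N = {(x, y). x \<in> bit_vectors k \<and> y \<in> bit_vectors k \<and>
    real (hweight k x + hweight k y) < \<delta> * (2 * real k)}"
  \<comment> \<open>The optimal Chernoff parameter: (1 + a)^(2k) / a^t equals the entropy expression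
    exactly. As \<delta> < 1/2 gives a < 1, powers of \<open>a\<close> decrease with the
    weight.\<close>
  define a where "a = \<delta> / (1 - \<delta>)"
  define t where "t = \<delta> * (2 * real k)"
  have a: "0 < a" "a < 1" "1 + a = 1 / (1 - \<delta>)" using assms by (auto simp: a_def field_simps)
  have "real (card N) * a powr t = (\<Sum>(x, y)\<in>N. a powr t)" by simp
  also have "\<dots> \<le> (\<Sum>(x, y)\<in>N. a ^ (hweight k x + hweight k y))"
  proof (intro sum_mono, clarify)
    fix x y assume "(x, y) \<in> N"
    then have "a powr t \<le> a powr (real (hweight k x + hweight k y))"
      using a by (intro powr_mono') (auto simp: N_def t_def)
    then show "a powr t \<le> a ^ (hweight k x + hweight k y)" using a by (simp only: powr_realpow)
  qed
  also have "\<dots> \<le> (\<Sum>(x, y)\<in>bit_vectors k \<times> bit_vectors k. a ^ (hweight k x + hweight k y))"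
    using a by (intro sum_mono2) (auto simp: N_def)
  also have "\<dots> = (\<Sum>x\<in>bit_vectors k. a ^ hweight k x) * (\<Sum>y\<in>bit_vectors k. a ^ hweight k y)"
    by (simp add: sum_product sum.cartesian_product power_add)
  also have "\<dots> = (1 / (1 - \<delta>)) powr (2 * real k)"
    using assms by (simp add: sum_power_hweight a(3) powr_realpow[symmetric] powr_add[symmetric])
  finally have "real (card N) \<le> (1 / (1 - \<delta>)) powr (2 * real k) / a powr t"
    using a by (simp add: field_simps)
  also have "\<dots> = exp (- (\<delta> * ln \<delta> + (1 - \<delta>) * ln (1 - \<delta>)) * (2 * real k))"
    using assms a(1) by (simp add: powr_def a_def t_def ln_div exp_diff[symmetric] algebra_simps)
  also have "\<dots> = 2 powr (binary_entropy \<delta> * (2 * real k))"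
    using assms by (simp add: powr_def binary_entropy_eq_ln)
  finally show ?thesis unfolding N_def .
qed

section \<open>The systematic code and its dual\<close>

definition code_of :: "nat \<Rightarrow> nat \<Rightarrow> (nat \<Rightarrow> nat \<Rightarrow> bit) \<Rightarrow> bit vec set" where
  "code_of n k A = {mat n k (\<lambda>(j, i). A j i) *\<^sub>v x |x. x \<in> carrier_vec k}"

lemma index_mat_mult_vec:
  assumes "x \<in> carrier_vec k" "j < n"
  shows "(mat n k (\<lambda>(j, i). A j i) *\<^sub>v x) $ j = mat_app k A (\<lambda>i. x $ i) j"
  using assms by (simp add: scalar_prod_def mat_app_def lessThan_atLeast0)

lemma finite_carrier_vec_bit: "finite (carrier_vec k :: bit vec set)"
proof (rule finite_subset)
  show "carrier_vec k \<subseteq> vec k ` bit_vectors k"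
  proof
    fix x :: "bit vec" assume "x \<in> carrier_vec k"
    then have "x = vec k (restrict (\<lambda>i. x $ i) {..<k})" by auto
    then show "x \<in> vec k ` bit_vectors k" using restrict_in_bit_vectors by blast
  qed
qed simp

text \<open>By \<open>inj\<close> the kernel is trivial, so rank-nullity gives dimension
  \<open>k\<close>.\<close>

lemma encodable_code_of:
  assumes inj: "\<And>x. \<exists>i<k. x i \<noteq> 0 \<Longrightarrow> \<exists>j<n. mat_app k A x j \<noteq> 0"
    and cost: "lin_cost k n A s" and k: "k > 0" and s: "real s \<le> s'"
  shows "linear_code n (code_of n k A)" "code_dim n (code_of n k A) = k"
    "encodable_in_size n k (code_of n k A) s'"
proof -
  define G where "G = mat n k (\<lambda>(j, i). A j i)"
  have G: "G \<in> carrier_mat n k" by (simp add: G_def)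
  interpret V: vec_space "TYPE(bit)" k .
  interpret W: vec_space "TYPE(bit)" n .
  interpret lm: linear_map "class_ring :: bit ring" "module_vec TYPE(bit) k" "module_vec TYPE(bit) n" "(*\<^sub>v) G"
  proof (intro linear_map.intro mod_hom.intro mod_hom_axioms.intro)
    show "vectorspace (class_ring :: bit ring) (module_vec TYPE(bit) k)" by (rule vec_vs)
    show "vectorspace (class_ring :: bit ring) (module_vec TYPE(bit) n)" by (rule vec_vs)
    show "module (class_ring :: bit ring) (module_vec TYPE(bit) k)" by (rule vec_module)
    show "module (class_ring :: bit ring) (module_vec TYPE(bit) n)" by (rule vec_module)
    show "(*\<^sub>v) G \<in> LinearCombinations.module_hom class_ring (module_vec TYPE(bit) k) (module_vec TYPE(bit) n)"
      using G by (auto simp: LinearCombinations.module_hom_def module_vec_simps mult_add_distrib_mat_vec mult_mat_vec)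
  qed
  have "lm.im = (*\<^sub>v) G ` carrier_vec k" by (simp add: lm.im_def module_vec_simps)
  then have im: "lm.im = code_of n k A" by (auto simp: code_of_def G_def)
  show lin: "linear_code n (code_of n k A)"
    unfolding linear_code_def using lm.imT_is_subspace im by simp
  have "inj_on ((*\<^sub>v) G) (carrier_vec k)"
  proof (rule inj_onI)
    fix x y :: "bit vec" assume xy: "x \<in> carrier_vec k" "y \<in> carrier_vec k" "G *\<^sub>v x = G *\<^sub>v y"
    have eq: "mat_app k A (\<lambda>i. x $ i) j = mat_app k A (\<lambda>i. y $ i) j" if "j < n" for j
      using index_mat_mult_vec[OF xy(1) that, of A] index_mat_mult_vec[OF xy(2) that, of A] xy(3)
      by (simp only: G_def)
    have "x $ i = y $ i" if "i < k" for i
    proof (rule ccontr)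
      assume "x $ i \<noteq> y $ i"
      then have "\<exists>i<k. x $ i - y $ i \<noteq> 0" using that by (metis eq_iff_diff_eq_0)
      from inj[OF this] obtain j where "j < n" "mat_app k A (\<lambda>i. x $ i - y $ i) j \<noteq> 0" by blast
      moreover have "mat_app k A (\<lambda>i. x $ i - y $ i) j =
          mat_app k A (\<lambda>i. x $ i) j - mat_app k A (\<lambda>i. y $ i) j" for j
        by (simp only: mat_app_def right_diff_distrib sum_subtractf)
      ultimately show False using eq by (metis eq_iff_diff_eq_0)
    qed
    then show "x = y" using xy(1,2) by (intro eq_vecI) auto
  qed
  then have "vectorspace.dim class_ring (module_vec TYPE(bit) k\<lparr>carrier := lm.ker\<rparr>) = 0"
    by (intro lm.inj_imp_dim_ker0) (simp add: module_vec_simps)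
  moreover have "vectorspace.dim class_ring (module_vec TYPE(bit) n\<lparr>carrier := lm.im\<rparr>) +
      vectorspace.dim class_ring (module_vec TYPE(bit) k\<lparr>carrier := lm.ker\<rparr>) = V.dim"
    by (rule lm.rank_nullity) (rule V.fin_dim)
  ultimately show dim: "code_dim n (code_of n k A) = k"
    unfolding code_dim_def im V.dim_is_n by simp
  have "generator_matrix n k (code_of n k A) G"
    unfolding generator_matrix_def using lin dim G by (simp add: code_of_def G_def)
  moreover obtain c where "circuit_computes k c ((*\<^sub>v) G)" "circuit_size c \<le> s"
    using lin_cost_imp_circuit[OF cost k] unfolding G_def by blast
  moreover from this(2) have "real (circuit_size c) \<le> s'" using s by simp
  ultimately show "encodable_in_size n k (code_of n k A) s'"
    unfolding encodable_in_size_def by blast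
qed

lemma rel_distance_code_of_ge:
  assumes dist: "\<And>x. \<exists>i<k. x i \<noteq> 0 \<Longrightarrow> \<delta> * real n \<le> real (hweight n (mat_app k A x))"
    and "\<delta> > 0" "n > 0" "k > 0"
  shows "\<delta> \<le> rel_distance n (code_of n k A)"
proof -
  define G where "G = mat n k (\<lambda>(j, i). A j i)"
  have C: "code_of n k A = (*\<^sub>v) G ` carrier_vec k" by (auto simp: code_of_def G_def)
  have weight: "rel_weight (G *\<^sub>v x) = real (hweight n (mat_app k A (\<lambda>i. x $ i))) / real n"
    if "x \<in> carrier_vec k" for x
  proof -
    have "{i. i < dim_vec (G *\<^sub>v x) \<and> (G *\<^sub>v x) $ i \<noteq> 0} = {i\<in>{..<n}. mat_app k A (\<lambda>i. x $ i) i \<noteq> 0}"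
      using index_mat_mult_vec[OF that, of _ n A] by (auto simp: G_def)
    then show ?thesis by (simp add: rel_weight_def hweight_def G_def)
  qed
  have ge: "\<delta> \<le> rel_weight (G *\<^sub>v x)" if x: "x \<in> carrier_vec k" "\<exists>i<k. x $ i \<noteq> 0" for x
    using dist[OF x(2)] assms(3) unfolding weight[OF x(1)] by (simp add: pos_le_divide_eq)
  have nonzero: "\<exists>i<k. x $ i \<noteq> 0" if "x \<in> carrier_vec k" "G *\<^sub>v x \<noteq> 0\<^sub>v n" for x
  proof (rule ccontr)
    assume "\<not> ?thesis"
    then have "x = 0\<^sub>v k" using that(1) by (intro eq_vecI) auto
    then have "G *\<^sub>v x = 0\<^sub>v n" by (intro eq_vecI) (auto simp: G_def scalar_prod_def)
    then show False using that(2) by simp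
  qed
  have fin: "finite (code_of n k A - {0\<^sub>v n})" unfolding C using finite_carrier_vec_bit by auto
  \<comment> \<open>\<open>Min\<close> needs a nonzero codeword to range over. The image of a unit
    vector is one, since its weight is at least \<delta> > 0.\<close>
  define e where "e = (unit_vec k 0 :: bit vec)"
  have e: "e \<in> carrier_vec k" "\<exists>i<k. e $ i \<noteq> 0" using assms(4) by (auto simp: e_def)
  have "G *\<^sub>v e \<noteq> 0\<^sub>v n"
  proof
    assume *: "G *\<^sub>v e = 0\<^sub>v n"
    have "{i. i < dim_vec (0\<^sub>v n :: bit vec) \<and> (0\<^sub>v n :: bit vec) $ i \<noteq> 0} = {}" by auto
    then have "rel_weight (G *\<^sub>v e) = 0" unfolding * rel_weight_def by simp
    then show False using ge[OF e] assms(2) by simp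
  qed
  then have "code_of n k A - {0\<^sub>v n} \<noteq> {}" using e(1) unfolding C by blast
  then show ?thesis
    unfolding rel_distance_def using fin ge nonzero by (subst Min_ge_iff) (auto simp: C)
qed

text \<open>Exchanges the upper and the lower \<open>k\<close> rows, which turns (y, A^T y) into the
  dual codeword (A^T y, y).\<close>

definition swap_halves :: "nat \<Rightarrow> (nat \<Rightarrow> nat \<Rightarrow> 'b) \<Rightarrow> nat \<Rightarrow> nat \<Rightarrow> 'b" where
  "swap_halves k A j = A (if j < k then k + j else j - k)"

lemma mat_app_swap_halves:
  "mat_app k (swap_halves k' A) x j = mat_app k A x (if j < k' then k' + j else j - k')"
  by (simp add: mat_app_def swap_halves_def)

lemma lin_cost_swap_halves:
  assumes "lin_cost k (k' + k') A s"
  shows "lin_cost k (k' + k') (swap_halves k' A) s"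
proof (rule lin_costI)
  fix W :: "(bit vec \<Rightarrow> bit) set" and y
  assume W: "W \<noteq> {}" and y: "\<forall>i<k. y i \<in> W"
  obtain V u where V: "u \<le> s" "gate_steps u W V"
    "\<forall>j<k' + k'. (\<lambda>x. mat_app k A (\<lambda>i. y i x) j) \<in> V"
    using lin_costD[OF assms(1) W y] by (elim exE conjE)
  have "\<forall>j<k' + k'. (\<lambda>x. mat_app k (swap_halves k' A) (\<lambda>i. y i x) j) \<in> V"
    using V(3) by (simp only: mat_app_swap_halves) (auto split: if_splits)
  with V(1,2) show "\<exists>V u. u \<le> s \<and> gate_steps u W V \<and>
      (\<forall>j<k' + k'. (\<lambda>x. mat_app k (swap_halves k' A) (\<lambda>i. y i x) j) \<in> V)"
    by (intro exI conjI)
qed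

lemma hweight_swap_halves:
  "hweight (k + k) (mat_app k (swap_halves k A) x) = hweight (k + k) (mat_app k A x)"
proof -
  have "hweight k (mat_app k (swap_halves k A) x) = hweight k (\<lambda>j. mat_app k A x (k + j))"
    "hweight k (\<lambda>j. mat_app k (swap_halves k A) x (k + j)) = hweight k (mat_app k A x)"
    by (rule hweight_cong; simp add: mat_app_swap_halves)+
  then show ?thesis unfolding hweight_add by simp
qed

text \<open>The inner product of (u, v) with (x, A x) is that of u + A^T v with x. It vanishes for
  all x iff u = A^T v, signs being immaterial over F_2.\<close>

lemma dual_code_systematic:
  "dual_code (k + k) (code_of (k + k) k (systematic k A)) =
    code_of (k + k) k (swap_halves k (systematic k (mat_transp A)))"
proof -
  define n where "n = k + k"
  define G where "G = mat n k (\<lambda>(j, i). systematic k A j i)"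
  define B where "B = swap_halves k (systematic k (mat_transp A))"
  define H where "H = mat n k (\<lambda>(j, i). B j i)"
  have add_self: "u + v = 0 \<longleftrightarrow> u = v" for u v :: bit by (cases u; cases v) simp_all
  have inner: "v \<bullet> (G *\<^sub>v x) =
      (\<Sum>i<k. v $ i * x $ i) + (\<Sum>i<k. mat_app k (mat_transp A) (\<lambda>i. v $ (k + i)) i * x $ i)"
    if "v \<in> carrier_vec n" "x \<in> carrier_vec k" for v x :: "bit vec"
  proof -
    have "v \<bullet> (G *\<^sub>v x) = (\<Sum>j<k + k. v $ j * mat_app k (systematic k A) (\<lambda>i. x $ i) j)"
      unfolding scalar_prod_def lessThan_atLeast0[symmetric]
      using index_mat_mult_vec[OF that(2), of _ n "systematic k A"]
      by (intro sum.cong) (auto simp: G_def n_def)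
    also have "\<dots> = (\<Sum>i<k. v $ i * x $ i) + (\<Sum>j<k. v $ (k + j) * mat_app k A (\<lambda>i. x $ i) j)"
      unfolding sum_lessThan_add by (simp only: mat_app_systematic) (auto intro!: arg_cong2[of _ _ _ _ "(+)"] sum.cong)
    also have "(\<Sum>j<k. v $ (k + j) * mat_app k A (\<lambda>i. x $ i) j) =
        (\<Sum>i<k. mat_app k (mat_transp A) (\<lambda>i. v $ (k + i)) i * x $ i)"
      using bilinear_dual[where y = "\<lambda>j. v $ (k + j)" and k = k and m = k and A = "mat_transp A" and z = "\<lambda>i. x $ i"] by simp
    finally show ?thesis .
  qed
  have index_H: "(H *\<^sub>v y) $ j = (if j < k then mat_app k (mat_transp A) (\<lambda>i. y $ i) j else y $ (j - k))"
    if "y \<in> carrier_vec k" "j < n" for y j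
    unfolding H_def index_mat_mult_vec[OF that]
    using that(2) by (auto simp: B_def n_def mat_app_swap_halves mat_app_systematic)
  have H_carrier: "H *\<^sub>v y \<in> carrier_vec n" for y by (intro carrier_vecI) (simp add: H_def)
  have H_orth: "(H *\<^sub>v y) \<bullet> (G *\<^sub>v x) = 0" if "y \<in> carrier_vec k" "x \<in> carrier_vec k" for x y
  proof -
    have "mat_app k (mat_transp A) (\<lambda>i. (H *\<^sub>v y) $ (k + i)) i = mat_app k (mat_transp A) (\<lambda>i. y $ i) i" for i
      by (rule mat_app_cong) (simp add: index_H[OF that(1)] n_def)
    moreover have "(\<Sum>i<k. (H *\<^sub>v y) $ i * x $ i) = (\<Sum>i<k. mat_app k (mat_transp A) (\<lambda>i. y $ i) i * x $ i)"
      by (intro sum.cong) (auto simp: index_H[OF that(1)] n_def)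
    ultimately show ?thesis unfolding inner[OF H_carrier that(2)] add_self by simp
  qed
  have orth_H: "\<exists>y\<in>carrier_vec k. v = H *\<^sub>v y"
    if v: "v \<in> carrier_vec n" "\<And>x. x \<in> carrier_vec k \<Longrightarrow> v \<bullet> (G *\<^sub>v x) = 0" for v
  proof
    \<comment> \<open>The lower half of \<open>v\<close> has to be the message; testing
      \<open>v\<close> against the codewords of unit vectors recovers its upper half.\<close>
    define y where "y = vec k (\<lambda>i. v $ (k + i))"
    show y: "y \<in> carrier_vec k" by (simp add: y_def)
    show "v = H *\<^sub>v y"
    proof (rule eq_vecI)
      show "dim_vec v = dim_vec (H *\<^sub>v y)" using v(1) by (simp add: H_def)
      fix j assume "j < dim_vec (H *\<^sub>v y)"
      then have j: "j < n" by (simp add: H_def)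
      show "v $ j = (H *\<^sub>v y) $ j"
      proof (cases "j < k")
        case True
        have unit: "(\<Sum>i<k. u i * (unit_vec k j :: bit vec) $ i) = u j" for u
          using True by (subst sum_single[of _ j]) auto
        have "mat_app k (mat_transp A) (\<lambda>i. v $ (k + i)) j = mat_app k (mat_transp A) (\<lambda>i. y $ i) j"
          by (rule mat_app_cong) (simp add: y_def)
        then show ?thesis
          using v(2)[of "unit_vec k j"] True j unfolding inner[OF v(1) unit_vec_carrier] unit add_self
          by (simp add: index_H[OF y])
      next
        case False
        then have "(H *\<^sub>v y) $ j = y $ (j - k)" using index_H[OF y j] by simp
        also have "\<dots> = v $ (k + (j - k))"
          using False j unfolding y_def n_def by (intro index_vec) linarith
        also have "k + (j - k) = j" using False by linarith
        finally show ?thesis by simp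
      qed
    qed
  qed
  have "vec_module.orthogonal_complement n (code_of n k (systematic k A)) = code_of n k B"
  proof (rule Set.set_eqI)
    fix v :: "bit vec"
    have "v \<in> vec_module.orthogonal_complement n (code_of n k (systematic k A)) \<longleftrightarrow>
        v \<in> carrier_vec n \<and> (\<forall>x\<in>carrier_vec k. v \<bullet> (G *\<^sub>v x) = 0)"
      unfolding vec_module.orthogonal_complement_def code_of_def G_def by auto
    also have "\<dots> \<longleftrightarrow> (\<exists>y\<in>carrier_vec k. v = H *\<^sub>v y)"
      using H_orth orth_H H_carrier by blast
    also have "\<dots> \<longleftrightarrow> v \<in> code_of n k B" unfolding code_of_def H_def by auto
    finally show "v \<in> vec_module.orthogonal_complement n (code_of n k (systematic k A)) \<longleftrightarrow>
        v \<in> code_of n k B" .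
  qed
  then show ?thesis unfolding n_def B_def .
qed

section \<open>Choice of parameters and assembly of the code and its dual\<close>

theorem theorem1p2:
  fixes \<epsilon> :: real
  assumes "\<epsilon> > 0"
  shows "\<exists>K :: real. K > 0 \<and>
    (\<exists>N :: nat. \<forall>n \<ge> N. even n \<longrightarrow>
      (\<exists>C :: bit vec set.
         linear_code n C \<and> code_dim n C = n div 2 \<and>
         rel_distance n C \<ge> GV_distance (1/2) - \<epsilon> \<and>
         rel_distance n (dual_code n C) \<ge> GV_distance (1/2) - \<epsilon> \<and>
         encodable_in_size n (n div 2) C (K * real n) \<and>
         encodable_in_size n (n div 2) (dual_code n C) (K * real n)))"
proof -
  obtain s where s: "\<forall>k>0. \<forall>t::real.
     2 * real (card {(x, y). x \<in> bit_vectors k \<and> y \<in> bit_vectors k \<and> real (hweight k x + hweight k y) < t}) < 2 ^ k \<longrightarrow>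
     (\<exists>A. lin_cost k k A (s * k) \<and> lin_cost k k (mat_transp A) (s * k) \<and>
       (\<forall>x. (\<exists>i<k. x i \<noteq> 0) \<longrightarrow> t \<le> real (hweight k x + hweight k (mat_app k A x)) \<and>
         t \<le> real (hweight k x + hweight k (mat_app k (mat_transp A) x))))"
    using exists_good_linear_map by (elim exE)
  \<comment> \<open>The maximum keeps \<delta> positive for large \<epsilon>; 1/32 lies below the
    lower bound 1/16 on the Gilbert-Varshamov distance.\<close>
  define \<delta> where "\<delta> = max (GV_distance (1/2) - \<epsilon>) (1/32)"
  have \<delta>: "0 < \<delta>" "\<delta> < GV_distance (1/2)" "GV_distance (1/2) - \<epsilon> \<le> \<delta>"
    using assms GV_distance_half(2) by (auto simp: \<delta>_def)
  then have "\<delta> < 1/2" using GV_distance_half(3) by simp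
  define h where "h = binary_entropy \<delta>"
  have h: "h < 1/2"
    using binary_entropy_strict_mono[of \<delta> "GV_distance (1/2)"] \<delta> GV_distance_half by (simp add: h_def)
  \<comment> \<open>For k >= N this gives k (1 - 2 h) > 1, so twice the number of light pairs, at
    most 2^(1 + 2 h k), is below 2^k.\<close>
  obtain N :: nat where N: "1 / (1 - 2 * h) < real N" using reals_Archimedean2 by blast
  define K where "K = real s + 1"
  have "\<exists>C :: bit vec set.
      linear_code n C \<and> code_dim n C = n div 2 \<and>
      rel_distance n C \<ge> GV_distance (1/2) - \<epsilon> \<and>
      rel_distance n (dual_code n C) \<ge> GV_distance (1/2) - \<epsilon> \<and>
      encodable_in_size n (n div 2) C (K * real n) \<and>
      encodable_in_size n (n div 2) (dual_code n C) (K * real n)" if n: "2 * N + 2 \<le> n" "even n" for n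
  proof -
    define k where "k = n div 2"
    \<comment> \<open>The summand 2 in the bound on \<open>n\<close> guarantees
      \<open>k > 0\<close>.\<close>
    have nk: "n = k + k" and k: "k > 0" "N \<le> k" using n by (auto simp: k_def)
    have "1 < real k * (1 - 2 * h)"
    proof -
      have "1 < real N * (1 - 2 * h)" using N h by (simp add: field_simps)
      also have "\<dots> \<le> real k * (1 - 2 * h)" using k(2) h by (intro mult_right_mono) auto
      finally show ?thesis .
    qed
    then have exponent: "1 + h * (2 * real k) < real k" by (simp add: algebra_simps)
    define t where "t = \<delta> * (2 * real k)"
    have "2 * real (card {(x, y). x \<in> bit_vectors k \<and> y \<in> bit_vectors k \<and> real (hweight k x + hweight k y) < t})
        \<le> 2 * 2 powr (h * (2 * real k))"
      unfolding t_def h_def using \<delta>(1) \<open>\<delta> < 1/2\<close> by (intro mult_left_mono card_light_pairs_le) auto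
    also have "\<dots> = 2 powr (1 + h * (2 * real k))" by (simp add: powr_add)
    also have "\<dots> < 2 powr real k" using exponent by (intro powr_less_mono) auto
    also have "\<dots> = 2 ^ k" by (simp add: powr_realpow)
    finally have few: "2 * real (card {(x, y). x \<in> bit_vectors k \<and> y \<in> bit_vectors k \<and>
        real (hweight k x + hweight k y) < t}) < 2 ^ k" .
    obtain A where cost: "lin_cost k k A (s * k)" "lin_cost k k (mat_transp A) (s * k)"
      and dist: "\<forall>x. (\<exists>i<k. x i \<noteq> 0) \<longrightarrow> t \<le> real (hweight k x + hweight k (mat_app k A x)) \<and>
         t \<le> real (hweight k x + hweight k (mat_app k (mat_transp A) x))"
      using s[rule_format, OF k(1) few] by (elim exE conjE)
    define G where "G = systematic k A"
    define H where "H = swap_halves k (systematic k (mat_transp A))"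
    have GH_cost: "lin_cost k n G (s * k)" "lin_cost k n H (s * k)"
      unfolding G_def H_def nk by (intro lin_cost_systematic lin_cost_swap_halves cost)+
    have G_dist: "\<delta> * real n \<le> real (hweight n (mat_app k G x))"
      and H_dist: "\<delta> * real n \<le> real (hweight n (mat_app k H x))" if "\<exists>i<k. x i \<noteq> 0" for x
      using dist that unfolding G_def H_def nk hweight_swap_halves hweight_systematic t_def by auto
    \<comment> \<open>Positive distance makes the encoding injective, as
      \<open>encodable_code_of\<close> requires.\<close>
    have pos: "\<exists>j<n. mat_app k F x j \<noteq> 0" if "\<delta> * real n \<le> real (hweight n (mat_app k F x))" for F x
    proof (rule ccontr)
      assume "\<not> ?thesis"
      then have "{j\<in>{..<n}. mat_app k F x j \<noteq> 0} = {}" by blast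
      then have "hweight n (mat_app k F x) = 0" unfolding hweight_def by simp
      moreover have "0 < \<delta> * real n" using \<delta>(1) k(1) nk by simp
      ultimately show False using that by simp
    qed
    have size: "real (s * k) \<le> K * real n" by (simp add: K_def nk algebra_simps)
    have dual: "dual_code n (code_of n k G) = code_of n k H"
      unfolding G_def H_def nk by (rule dual_code_systematic)
    have "0 < n" using k nk by simp
    then show ?thesis
      using encodable_code_of[OF pos[OF G_dist] GH_cost(1) k(1) size]
        encodable_code_of[OF pos[OF H_dist] GH_cost(2) k(1) size]
        rel_distance_code_of_ge[OF G_dist \<delta>(1) _ k(1)] rel_distance_code_of_ge[OF H_dist \<delta>(1) _ k(1)] \<delta>(3)
      by (intro exI[of _ "code_of n k G"]) (auto simp: dual k_def[symmetric])
  qed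
  moreover have "K > 0" by (simp add: K_def)
  ultimately show ?thesis by blast
qed

end
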